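(* Let $R=\mathbb{Q}[[x_1,x_2,x_3,\ldots]]/\overline{\mathcal{J}}$, where $\mathcal{J}$ is the ideal of $\mathbb{Q}[[x_1,x_2,\ldots]]$ generated by all non-constant quasi-symmetric functions and $\overline{\mathcal{J}}$ is its closure. Then the images in $R$ of the monomials $X^{\tilde\alpha}=x_1^{\tilde\alpha_1}x_2^{\tilde\alpha_2}\cdots$ whose associated path is a Catalan path form a (monomial) Hilbert basis of $R$.
   Context: $\mathbb{Q}[[x_1,x_2,\ldots]]$ denotes the ring of formal power series in countably many variables, i.e. formal (possibly infinite) $\mathbb{Q}$-linear combinations of monomials $X^{\tilde\alpha}=x_1^{\tilde\alpha_1}x_2^{\tilde\alpha_2}\cdots$ of finite total degree, with its standard (formal power series) topology; the closure $\overline{\mathcal{J}}$ is taken with respect to it. A (standard) composition $\alpha=[\alpha_1,\ldots,\alpha_k]$ of $d$ is a finite sequence of positive integers with sum $d$; set $D(\alpha)=\{\alpha_1,\alpha_1+\alpha_2,\ldots,\alpha_1+\cdots+\alpha_{k-1}\}$. The fundamental quasi-symmetric function is $F_\alpha(x_1,x_2,\ldots)=\sum x_{j_1}x_{j_2}\cdots x_{j_d}$, summed over $j_1\le j_2\le\cdots\le j_d$ with $j_i<j_{i+1}$ whenever $i\in D(\alpha)$; the quasi-symmetric functions are the $\mathbb{Q}$-linear span of the $F_\alpha$ (with $F$ of the empty composition equal to $1$), and the non-constant ones are spanned by the $F_\alpha$ with $d>0$. A generalized composition $\tilde\alpha=(\tilde\alpha_1,\tilde\alpha_2,\ldots)$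 is an infinite sequence of nonnegative integers with finite sum. Its associated path starts at $(0,0)$, takes $\tilde\alpha_1$ unit east steps, then one north step, then $\tilde\alpha_2$ east steps, one north step, then $\tilde\alpha_3$ east steps, and so on. It is a Catalan path if it stays weakly above the line $y=x$, i.e. every lattice point $(x,y)$ on it satisfies $x-y\le 0$ (equivalently $\tilde\alpha_1+\cdots+\tilde\alpha_j\le j-1$ for all $j\ge1$). A Hilbert basis of $R$ means a family of elements such that every element of $R$ is expressible uniquely as a (possibly infinite, convergent) $\mathbb{Q}$-linear combination of them. *)

theory Defs
  imports
    "HOL-Algebra.QuotRing"
    "HOL-Analysis.Analysis"
    "HOL-Library.Poly_Mapping"
begin

section \<open>The topological ring of power series in countably many variables\<close>

text \<open>
  A generalized composition, i.e. the exponent vector of a monomial, is a finitely supported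
  map from nat to nat. Indices are shifted by one: index i belongs to the variable x_(i+1).
  A power series is its coefficient function; no bound on the degrees is imposed.
\<close>

type_synonym gcomp = "nat \<Rightarrow>\<^sub>0 nat"
type_synonym mpseries = "gcomp \<Rightarrow> rat"

definition monom_series :: "gcomp \<Rightarrow> mpseries" where
  "monom_series \<alpha> = (\<lambda>m. if m = \<alpha> then 1 else 0)"

definition const_series :: "rat \<Rightarrow> mpseries" where
  "const_series c = (\<lambda>m. if m = 0 then c else 0)"

definition conv :: "mpseries \<Rightarrow> mpseries \<Rightarrow> mpseries" where
  "conv f g = (\<lambda>m. \<Sum>(a, b) | a + b = m. f a * g b)"

definition PS :: "mpseries ring" where
  "PS = \<lparr>carrier = UNIV, monoid.mult = conv, one = const_series 1,
         zero = (\<lambda>m. 0), add = (\<lambda>f g m. f m + g m)\<rparr>"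

text \<open>The power series topology: coefficientwise convergence, with discrete coefficients.\<close>

definition PS_topology :: "mpseries topology" where
  "PS_topology = product_topology (\<lambda>_. discrete_topology UNIV) UNIV"

definition quotient_topology :: "'a topology \<Rightarrow> ('a \<Rightarrow> 'b) \<Rightarrow> 'b topology" where
  "quotient_topology T p =
     topology (\<lambda>U. U \<subseteq> p ` topspace T \<and> openin T {x \<in> topspace T. p x \<in> U})"


section \<open>Quasi-symmetric functions\<close>

definition composition :: "nat list \<Rightarrow> bool" where
  "composition \<alpha> \<longleftrightarrow> (\<forall>a \<in> set \<alpha>. 0 < a)"

definition descents :: "nat list \<Rightarrow> nat set" where
  "descents \<alpha> = {sum_list (take i \<alpha>) | i. 1 \<le> i \<and> i < length \<alpha>}"

text \<open>
  The index sequences j_1 \<le> ... \<le> j_d of the defining sum of F_\<alpha>. Descents count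
  positions from 1 while lists count from 0, so position i + 1 is js ! i.
\<close>

definition fundamental_indices :: "nat list \<Rightarrow> nat list set" where
  "fundamental_indices \<alpha> =
     {js. length js = sum_list \<alpha> \<and>
          (\<forall>i. Suc i < length js \<longrightarrow>
             js ! i \<le> js ! Suc i \<and> (Suc i \<in> descents \<alpha> \<longrightarrow> js ! i < js ! Suc i))}"

definition word_monom :: "nat list \<Rightarrow> gcomp" where
  "word_monom js = (\<Sum>j\<leftarrow>js. Poly_Mapping.single j 1)"

text \<open>The coefficient of a monomial in the formal sum is the number of terms equal to it.\<close>

definition fundamental_qsym :: "nat list \<Rightarrow> mpseries" where
  "fundamental_qsym \<alpha> = (\<lambda>m. of_nat (card {js \<in> fundamental_indices \<alpha>. word_monom js = m}))"

definition lin_span :: "mpseries set \<Rightarrow> mpseries set" where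
  "lin_span B = {\<lambda>m. \<Sum>f\<in>S. c f * f m | S c. finite S \<and> S \<subseteq> B}"

definition nonconst_qsym :: "mpseries set" where
  "nonconst_qsym = lin_span (fundamental_qsym ` {\<alpha>. composition \<alpha> \<and> 0 < sum_list \<alpha>})"


section \<open>The quotient ring\<close>

definition J_ideal :: "mpseries set" where
  "J_ideal = Idl\<^bsub>PS\<^esub> nonconst_qsym"

definition J_closure :: "mpseries set" where
  "J_closure = PS_topology closure_of J_ideal"

definition R_ring :: "mpseries set ring" where
  "R_ring = PS Quot J_closure"

definition R_class :: "mpseries \<Rightarrow> mpseries set" where
  "R_class f = J_closure +>\<^bsub>PS\<^esub> f"

definition R_topology :: "mpseries set topology" where
  "R_topology = quotient_topology PS_topology R_class"


section \<open>Catalan paths\<close>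

text \<open>
  At height y (counted from 0) the path runs from abscissa \<alpha>_1 + ... + \<alpha>_y
  east by \<alpha>_(y+1) unit steps, and then one step north.
\<close>

definition lattice_path :: "gcomp \<Rightarrow> (nat \<times> nat) set" where
  "lattice_path \<alpha> =
     {((\<Sum>i<y. Poly_Mapping.lookup \<alpha> i) + k, y) | y k. k \<le> Poly_Mapping.lookup \<alpha> y}"

definition catalan_path :: "gcomp \<Rightarrow> bool" where
  "catalan_path \<alpha> \<longleftrightarrow> (\<forall>(x, y) \<in> lattice_path \<alpha>. int x - int y \<le> 0)"


section \<open>Hilbert bases\<close>

text \<open>
  The map \<iota> is the structure map of the rational algebra R. Convergence of an infinite linear
  combination means convergence of the net of its finite partial sums. Coefficient families
  are extensional so that uniqueness only concerns the index set A.
\<close>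

definition hilbert_basis ::
    "('r, 's) ring_scheme \<Rightarrow> 'r topology \<Rightarrow> (rat \<Rightarrow> 'r) \<Rightarrow> ('i \<Rightarrow> 'r) \<Rightarrow> 'i set \<Rightarrow> bool" where
  "hilbert_basis R T \<iota> b A \<longleftrightarrow>
     b \<in> A \<rightarrow> carrier R \<and>
     (\<forall>r \<in> carrier R. \<exists>!c. c \<in> extensional A \<and>
        limitin T (\<lambda>S. \<Oplus>\<^bsub>R\<^esub>i\<in>S. \<iota> (c i) \<otimes>\<^bsub>R\<^esub> b i) r (finite_subsets_at_top A))"


section \<open>Well-definedness\<close>

lemma finite_gcomp_le: "finite {a :: gcomp. \<forall>i. Poly_Mapping.lookup a i \<le> Poly_Mapping.lookup m i}" (is "finite ?S")
proof -
  let ?N = "\<Sum>i\<in>Poly_Mapping.keys m. Poly_Mapping.lookup m i"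
  let ?F = "{f. \<forall>i. (i \<in> Poly_Mapping.keys m \<longrightarrow> f i \<in> {..?N}) \<and> (i \<notin> Poly_Mapping.keys m \<longrightarrow> f i = 0)}"
  have "finite ?F"
    by (rule finite_set_of_finite_funs) auto
  moreover have "Poly_Mapping.lookup ` ?S \<subseteq> ?F"
  proof (clarsimp, intro allI conjI impI)
    fix a :: gcomp and i
    assume a: "\<forall>i. Poly_Mapping.lookup a i \<le> Poly_Mapping.lookup m i"
    { assume "i \<in> Poly_Mapping.keys m"
      then have "Poly_Mapping.lookup m i \<le> ?N"
        by (intro member_le_sum) auto
      then show "Poly_Mapping.lookup a i \<le> ?N" using a le_trans by blast }
    { assume "i \<notin> Poly_Mapping.keys m"
      then show "Poly_Mapping.lookup a i = 0"
        using a[rule_format, of i] by (simp add: in_keys_iff) }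
  qed
  ultimately have "finite (Poly_Mapping.lookup ` ?S)" using finite_subset by blast
  then show ?thesis
    by (rule finite_imageD) (simp add: inj_on_def poly_mapping_eqI)
qed

lemma finite_splittings [simp]: "finite {(a :: gcomp, b). a + b = m}"
proof (rule finite_subset)
  let ?S = "{a :: gcomp. \<forall>i. Poly_Mapping.lookup a i \<le> Poly_Mapping.lookup m i}"
  show "{(a, b). a + b = m} \<subseteq> ?S \<times> ?S"
    by (auto simp: lookup_add)
  show "finite (?S \<times> ?S)"
    using finite_gcomp_le by blast
qed

lemma conv_commute: "conv f g = conv g f"
proof
  fix m
  show "conv f g m = conv g f m"
    unfolding conv_def
    by (rule sum.reindex_bij_witness[where i = prod.swap and j = prod.swap])
       (auto simp: add.commute mult.commute)
qed

lemma conv_assoc: "conv (conv f g) h = conv f (conv g h)"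
proof
  fix m
  have "conv (conv f g) h m =
      (\<Sum>p | fst p + snd p = m. \<Sum>q | fst q + snd q = fst p. f (fst q) * g (snd q) * h (snd p))"
    unfolding conv_def by (simp add: case_prod_unfold sum_distrib_right)
  also have "\<dots> = (\<Sum>(p, q)\<in>(SIGMA p:{p. fst p + snd p = m}. {q. fst q + snd q = fst p}).
      f (fst q) * g (snd q) * h (snd p))"
    using finite_splittings by (subst sum.Sigma) (auto simp: case_prod_unfold)
  also have "\<dots> = (\<Sum>(p, q)\<in>(SIGMA p:{p. fst p + snd p = m}. {q. fst q + snd q = snd p}).
      f (fst p) * (g (fst q) * h (snd q)))"
    by (rule sum.reindex_bij_witness
         [where i = "\<lambda>((a, bc), (b, c)). ((a + b, c), (a, b))"
            and j = "\<lambda>((ab, c), (a, b)). ((a, b + c), (b, c))"])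
       (auto simp: algebra_simps)
  also have "\<dots> = (\<Sum>p | fst p + snd p = m. \<Sum>q | fst q + snd q = snd p. f (fst p) * (g (fst q) * h (snd q)))"
    using finite_splittings by (subst sum.Sigma) (auto simp: case_prod_unfold)
  also have "\<dots> = conv f (conv g h) m"
    unfolding conv_def by (simp add: case_prod_unfold sum_distrib_left)
  finally show "conv (conv f g) h m = conv f (conv g h) m" .
qed

lemma conv_const_left: "conv (const_series c) f = (\<lambda>m. c * f m)"
proof
  fix m
  have "conv (const_series c) f m = (\<Sum>p\<in>{(0, m)}. const_series c (fst p) * f (snd p))"
    unfolding conv_def case_prod_unfold
    by (rule sum.mono_neutral_right)
       (use finite_splittings in \<open>auto simp: const_series_def case_prod_unfold\<close>)
  then show "conv (const_series c) f m = c * f m" by (simp add: const_series_def)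
qed

lemma conv_add_left: "conv (\<lambda>m. f m + g m) h = (\<lambda>m. conv f h m + conv g h m)"
  by (rule ext) (simp add: conv_def case_prod_unfold distrib_right sum.distrib)

lemma PS_cring: "cring PS"
proof (rule cringI)
  show "abelian_group PS"
  proof (rule abelian_groupI)
    show "\<exists>y\<in>carrier PS. y \<oplus>\<^bsub>PS\<^esub> x = \<zero>\<^bsub>PS\<^esub>" for x
      by (rule bexI[where x = "\<lambda>m. - x m"]) (auto simp: PS_def)
  qed (auto simp: PS_def algebra_simps)
  show "Group.comm_monoid PS"
  proof (rule comm_monoidI)
    show "x \<otimes>\<^bsub>PS\<^esub> y = y \<otimes>\<^bsub>PS\<^esub> x" for x y
      using conv_commute[of x y] by (simp add: PS_def)
  qed (simp_all add: PS_def conv_assoc conv_const_left)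
qed (auto simp: PS_def conv_add_left)

lemma finite_fundamental_indices: "finite {js \<in> fundamental_indices \<alpha>. word_monom js = m}"
proof (rule finite_subset)
  have *: "set js \<subseteq> Poly_Mapping.keys (word_monom js)" for js
  proof (induction js)
    case (Cons j js)
    then show ?case
      by (auto simp: word_monom_def in_keys_iff lookup_add lookup_single subset_iff)
  qed simp
  show "{js \<in> fundamental_indices \<alpha>. word_monom js = m}
      \<subseteq> {js. set js \<subseteq> Poly_Mapping.keys m \<and> length js = sum_list \<alpha>}"
    using * by (auto simp: fundamental_indices_def)
  show "finite {js. set js \<subseteq> Poly_Mapping.keys m \<and> length js = sum_list \<alpha>}"
    by (rule finite_lists_length_eq) simp
qed

lemma in_closure_PS:
  "f \<in> PS_topology closure_of S \<longleftrightarrow> (\<forall>M. finite M \<longrightarrow> (\<exists>g\<in>S. \<forall>m\<in>M. g m = f m))"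
proof
  assume f: "f \<in> PS_topology closure_of S"
  show "\<forall>M. finite M \<longrightarrow> (\<exists>g\<in>S. \<forall>m\<in>M. g m = f m)"
  proof (intro allI impI)
    fix M :: "gcomp set" assume M: "finite M"
    let ?U = "PiE UNIV (\<lambda>m. if m \<in> M then {f m} else UNIV)"
    have "openin PS_topology ?U"
      unfolding PS_topology_def
      by (rule product_topology_basis) (use M in \<open>auto elim: finite_subset[rotated]\<close>)
    moreover have "f \<in> ?U" by auto
    ultimately obtain g where "g \<in> S" "g \<in> ?U"
      using f unfolding in_closure_of by blast
    then show "\<exists>g\<in>S. \<forall>m\<in>M. g m = f m"
      by (intro bexI[of _ g]) (auto simp: PiE_iff split: if_splits)
  qed
next
  assume *: "\<forall>M. finite M \<longrightarrow> (\<exists>g\<in>S. \<forall>m\<in>M. g m = f m)"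
  show "f \<in> PS_topology closure_of S"
    unfolding in_closure_of
  proof (intro conjI allI impI)
    show "f \<in> topspace PS_topology" by (simp add: PS_topology_def)
    fix T assume "f \<in> T \<and> openin PS_topology T"
    then obtain U where U: "finite {i. U i \<noteq> UNIV}" "f \<in> PiE UNIV U" "PiE UNIV U \<subseteq> T"
      unfolding PS_topology_def openin_product_topology_alt by auto
    from * U(1) obtain g where g: "g \<in> S" "\<forall>m\<in>{i. U i \<noteq> UNIV}. g m = f m" by blast
    have "g m \<in> U m" for m
    proof (cases "U m = UNIV")
      case False
      then have "g m = f m" using g(2) by blast
      then show ?thesis using U(2) by (auto simp: PiE_iff)
    qed auto
    then have "g \<in> PiE UNIV U" by (auto simp: PiE_iff)
    then show "\<exists>y. y \<in> S \<and> y \<in> T" using g U by blast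
  qed
qed

lemma J_ideal_ideal: "ideal J_ideal PS"
proof -
  interpret cring PS by (rule PS_cring)
  show ?thesis
    unfolding J_ideal_def by (rule genideal_ideal) (simp add: PS_def)
qed

lemma J_closure_ideal: "ideal J_closure PS"
proof -
  interpret cring PS by (rule PS_cring)
  interpret J: ideal J_ideal PS by (rule J_ideal_ideal)
  have add: "(\<lambda>m. f m + g m) \<in> J_closure" if "f \<in> J_closure" "g \<in> J_closure" for f g
    unfolding J_closure_def in_closure_PS
  proof (intro allI impI)
    fix M :: "gcomp set" assume M: "finite M"
    obtain f' where f': "f' \<in> J_ideal" "\<forall>m\<in>M. f' m = f m"
      using M \<open>f \<in> J_closure\<close> unfolding J_closure_def in_closure_PS by blast
    obtain g' where g': "g' \<in> J_ideal" "\<forall>m\<in>M. g' m = g m"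
      using M \<open>g \<in> J_closure\<close> unfolding J_closure_def in_closure_PS by blast
    have "(\<lambda>m. f' m + g' m) \<in> J_ideal"
      using J.a_closed[OF f'(1) g'(1)] by (simp add: PS_def)
    then show "\<exists>h\<in>J_ideal. \<forall>m\<in>M. h m = f m + g m"
      by (rule bexI[rotated]) (use f' g' in auto)
  qed
  have mult: "conv h f \<in> J_closure" if "f \<in> J_closure" for f h
    unfolding J_closure_def in_closure_PS
  proof (intro allI impI)
    fix M :: "gcomp set" assume M: "finite M"
    let ?M = "snd ` (\<Union>m\<in>M. {(a, b). a + b = m})"
    have "finite ?M" using M by auto
    then obtain g where g: "g \<in> J_ideal" "\<forall>m\<in>?M. g m = f m"
      using \<open>f \<in> J_closure\<close> unfolding J_closure_def in_closure_PS by blast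
    have "conv h g \<in> J_ideal"
      using J.I_l_closed[OF g(1), of h] by (simp add: PS_def)
    moreover have "conv h g m = conv h f m" if "m \<in> M" for m
      unfolding conv_def by (rule sum.cong) (use g(2) that in force)+
    ultimately show "\<exists>k\<in>J_ideal. \<forall>m\<in>M. k m = conv h f m" by blast
  qed
  have zero: "(\<lambda>m. 0) \<in> J_closure"
    using J.zero_closed unfolding J_closure_def in_closure_PS by (auto simp: PS_def)
  show ?thesis
  proof (rule idealI)
    show "ring PS" by (rule ring_axioms)
    show "subgroup J_closure (add_monoid PS)"
    proof (rule add.subgroupI)
      show "J_closure \<subseteq> carrier PS" by (simp add: PS_def)
      show "J_closure \<noteq> {}" using zero by blast
      show "\<ominus>\<^bsub>PS\<^esub> a \<in> J_closure" if "a \<in> J_closure" for a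
      proof -
        have "\<ominus>\<^bsub>PS\<^esub> a = (\<lambda>m. - a m)"
          by (rule sum_zero_eq_neg[symmetric]) (auto simp: PS_def)
        also have "\<dots> = conv (const_series (-1)) a" by (simp add: conv_const_left)
        finally show ?thesis using mult that by simp
      qed
      show "a \<oplus>\<^bsub>PS\<^esub> b \<in> J_closure" if "a \<in> J_closure" "b \<in> J_closure" for a b
        using add that by (simp add: PS_def)
    qed
    show "x \<otimes>\<^bsub>PS\<^esub> a \<in> J_closure" if "a \<in> J_closure" for a x
      using mult that by (simp add: PS_def)
    show "a \<otimes>\<^bsub>PS\<^esub> x \<in> J_closure" if "a \<in> J_closure" for a x
      using mult that by (simp add: PS_def conv_commute)
  qed
qed

lemma R_ring_cring: "cring R_ring"
  unfolding R_ring_def by (rule ideal.quotient_is_cring[OF J_closure_ideal PS_cring])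

lemma R_class_hom: "R_class \<in> ring_hom PS R_ring"
  using ideal.rcos_ring_hom[OF J_closure_ideal] by (simp add: R_class_def[abs_def] R_ring_def)

lemma quotient_map_quotient_topology: "quotient_map T (quotient_topology T p) p"
proof -
  have "istopology (\<lambda>U. U \<subseteq> p ` topspace T \<and> openin T {x \<in> topspace T. p x \<in> U})"
  proof -
    have inter: "{x \<in> topspace T. p x \<in> U \<inter> V} = {x \<in> topspace T. p x \<in> U} \<inter> {x \<in> topspace T. p x \<in> V}" for U V
      by auto
    have un: "{x \<in> topspace T. p x \<in> \<Union>K} = \<Union>((\<lambda>U. {x \<in> topspace T. p x \<in> U}) ` K)" for K
      by auto
    show ?thesis unfolding istopology_def inter un by blast
  qed
  then have op: "openin (quotient_topology T p) U \<longleftrightarrow>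
      U \<subseteq> p ` topspace T \<and> openin T {x \<in> topspace T. p x \<in> U}" for U
    unfolding quotient_topology_def by (simp add: topology_inverse')
  have "openin (quotient_topology T p) (p ` topspace T)"
    unfolding op by (auto intro: openin_subtopology_refl[THEN iffD2] simp: openin_topspace[of T] Collect_conj_eq cong: conj_cong)
  then have "topspace (quotient_topology T p) = p ` topspace T"
    using op openin_subset openin_topspace by (metis subset_antisym)
  then show ?thesis
    unfolding quotient_map_def by (auto simp: op)
qed

lemma topspace_R_topology: "topspace R_topology = carrier R_ring"
proof -
  have "topspace R_topology = R_class ` topspace PS_topology"
    unfolding R_topology_def
    using quotient_map_quotient_topology[of PS_topology R_class] by (simp add: quotient_map_def)
  then show ?thesis
    by (auto simp: PS_topology_def R_ring_def R_class_def FactRing_def A_RCOSETS_def' PS_def)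
qed

end

(*
  Order monomials lexicographically, x_1 being the most significant variable. If the path of a
  monomial goes below the diagonal, the monomial is the leading one of an element of the ideal:
  splitting off the first variable, this is shown by induction for the ideals generated by the
  F_alpha whose excess sum (alpha_i - 1) is at least h, where h + 1 is the overshoot of the path.
  So every series agrees with an element of the closed ideal off the Catalan monomials.
  Conversely, an element of the ideal whose coefficients vanish at the non-Catalan monomials with
  bounded support and degree vanishes at the Catalan ones as well. Otherwise, some Catalan
  monomial is its lexicographically largest one; divided differences, which map the ideal to
  itself, move this coefficient to a Catalan monomial of smaller degree, and finally to the
  constant term, which is zero. Both facts only concern finitely many
  coefficients at a time, hence they pass to the closure and to limits in the quotient.
*)
theory Submission
  imports Defs
begin

section \<open>Exponent vectors\<close>

definition gcons :: "nat \<Rightarrow> gcomp \<Rightarrow> gcomp" where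
  "gcons b m = Abs_poly_mapping (case_nat b (Poly_Mapping.lookup m))"

definition gtl :: "gcomp \<Rightarrow> gcomp" where
  "gtl m = Abs_poly_mapping (\<lambda>i. Poly_Mapping.lookup m (Suc i))"

text \<open>Here and below x_i is the variable at index \<open>i\<close>, so the first one is x_0.
  On coefficient functions, composition with \<open>gins i\<close> is the substitution x_i = 0
  followed by renumbering the later variables.\<close>

fun gins :: "nat \<Rightarrow> gcomp \<Rightarrow> gcomp" where
  "gins 0 m = gcons 0 m"
| "gins (Suc i) m = gcons (Poly_Mapping.lookup m 0) (gins i (gtl m))"

definition gdeg :: "gcomp \<Rightarrow> nat" where
  "gdeg m = (\<Sum>i\<in>Poly_Mapping.keys m. Poly_Mapping.lookup m i)"

abbreviation unit_exp :: "nat \<Rightarrow> gcomp" where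
  "unit_exp i \<equiv> Poly_Mapping.single i 1"

lemma lookup_gcons: "Poly_Mapping.lookup (gcons b m) = case_nat b (Poly_Mapping.lookup m)"
proof -
  have "{i. case_nat b (Poly_Mapping.lookup m) i \<noteq> 0} \<subseteq> insert 0 (Suc ` Poly_Mapping.keys m)"
  proof
    fix i assume "i \<in> {i. case_nat b (Poly_Mapping.lookup m) i \<noteq> 0}"
    then show "i \<in> insert 0 (Suc ` Poly_Mapping.keys m)"
      by (cases i) (auto simp: in_keys_iff)
  qed
  then have "finite {i. case_nat b (Poly_Mapping.lookup m) i \<noteq> 0}"
    by (rule finite_subset) simp
  then show ?thesis
    unfolding gcons_def by (rule Abs_poly_mapping_inverse[OF CollectI])
qed

lemma lookup_gcons_0 [simp]: "Poly_Mapping.lookup (gcons b m) 0 = b"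
  and lookup_gcons_Suc [simp]: "Poly_Mapping.lookup (gcons b m) (Suc i) = Poly_Mapping.lookup m i"
  by (simp_all add: lookup_gcons)

lemma lookup_gtl [simp]: "Poly_Mapping.lookup (gtl m) i = Poly_Mapping.lookup m (Suc i)"
proof -
  have "finite {i. Poly_Mapping.lookup m (Suc i) \<noteq> 0}"
    using finite_vimageI[of "Poly_Mapping.keys m" Suc] by (simp add: vimage_def in_keys_iff)
  then show ?thesis
    unfolding gtl_def by (simp add: Abs_poly_mapping_inverse)
qed

lemma gcomp_eq_iff: "m = n \<longleftrightarrow> (\<forall>i. Poly_Mapping.lookup m i = Poly_Mapping.lookup n i)"
  by (auto intro: poly_mapping_eqI)

lemma all_nat_split: "(\<forall>i. P i) \<longleftrightarrow> P 0 \<and> (\<forall>i. P (Suc i))"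
  by (metis not0_implies_Suc)

lemma gcons_gtl [simp]: "gcons (Poly_Mapping.lookup m 0) (gtl m) = m"
  by (subst gcomp_eq_iff, subst all_nat_split) simp

lemma gtl_gcons [simp]: "gtl (gcons b m) = m"
  by (simp add: gcomp_eq_iff)

lemma gcomp_cases [case_names gcons]: obtains b m' where "m = gcons b m'"
  using gcons_gtl by metis

lemma gcons_eq_iff [simp]: "gcons a m = gcons b n \<longleftrightarrow> a = b \<and> m = n"
  by (metis lookup_gcons_0 gtl_gcons)

lemma gcons_add: "gcons a m + gcons b n = gcons (a + b) (m + n)"
  by (subst gcomp_eq_iff, subst all_nat_split) (simp add: lookup_add)

lemma gcons_0_0 [simp]: "gcons 0 0 = 0"
  by (subst gcomp_eq_iff, subst all_nat_split) simp

lemma single_0_eq_gcons: "Poly_Mapping.single 0 a = gcons a 0"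
  by (subst gcomp_eq_iff, subst all_nat_split) (simp add: lookup_single when_def)

lemma single_Suc_eq_gcons: "Poly_Mapping.single (Suc i) a = gcons 0 (Poly_Mapping.single i a)"
  by (subst gcomp_eq_iff, subst all_nat_split) (simp add: lookup_single when_def)

text \<open>The library order on \<open>gcomp\<close> is lexicographic with index 0 most
  significant; leading monomials are the largest ones in it.\<close>

lemma less_gcomp_iff: "m < n \<longleftrightarrow> (\<exists>k. Poly_Mapping.lookup m k < Poly_Mapping.lookup n k \<and>
    (\<forall>i<k. Poly_Mapping.lookup m i = Poly_Mapping.lookup n i))" for m n :: gcomp
  by (simp add: less_poly_mapping.rep_eq less_fun_def)

lemma gcons_less_iff [simp]: "gcons a m < gcons b n \<longleftrightarrow> a < b \<or> a = b \<and> m < n"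
proof -
  have ex: "(\<exists>k. P k) \<longleftrightarrow> P 0 \<or> (\<exists>k. P (Suc k))" for P :: "nat \<Rightarrow> bool"
    by (metis not0_implies_Suc)
  show ?thesis
    unfolding less_gcomp_iff by (subst ex) (auto simp: All_less_Suc2)
qed

section \<open>Insertion of a zero exponent\<close>

lemma gins_Suc_gcons [simp]: "gins (Suc i) (gcons b m) = gcons b (gins i m)"
  by simp

declare gins.simps(2) [simp del]

lemma lookup_gins: "Poly_Mapping.lookup (gins i m) j =
    (if j < i then Poly_Mapping.lookup m j else if j = i then 0 else Poly_Mapping.lookup m (j - 1))"
proof (induction i arbitrary: j m)
  case 0
  then show ?case by (cases j) auto
next
  case (Suc i)
  then show ?case
    by (cases m rule: gcomp_cases; cases j) (auto simp: lookup_gcons split: nat.splits)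
qed

lemma gins_add: "gins i (m + n) = gins i m + gins i n"
  by (rule poly_mapping_eqI) (simp add: lookup_gins lookup_add)

lemma gins_eq_iff [simp]: "gins i m = gins i n \<longleftrightarrow> m = n"
proof (induction i arbitrary: m n)
  case (Suc i)
  then show ?case
    by (cases m rule: gcomp_cases; cases n rule: gcomp_cases) simp
qed simp

lemma gins_less_iff [simp]: "gins i m < gins i n \<longleftrightarrow> m < n"
proof (induction i arbitrary: m n)
  case (Suc i)
  then show ?case
    by (cases m rule: gcomp_cases; cases n rule: gcomp_cases) simp
qed simp

lemma gins_surj: "Poly_Mapping.lookup m i = 0 \<Longrightarrow> \<exists>n. m = gins i n"
proof (induction i arbitrary: m)
  case 0
  then show ?case by (cases m rule: gcomp_cases) auto
next
  case (Suc i)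
  obtain b m' where m: "m = gcons b m'" by (cases m rule: gcomp_cases)
  with Suc obtain n where "m' = gins i n" by auto
  with m have "m = gins (Suc i) (gcons b n)" by simp
  then show ?case by blast
qed

lemma gins_eq_gins_Suc: "Poly_Mapping.lookup m i = 0 \<Longrightarrow> gins (Suc i) m = gins i m"
  by (rule poly_mapping_eqI) (auto simp: lookup_gins less_Suc_eq)

lemma gins_Suc_single: "gins (Suc i) (unit_exp i) = unit_exp i"
  by (rule poly_mapping_eqI) (auto simp: lookup_gins lookup_single when_def)

lemma gins_single: "gins i (unit_exp i) = unit_exp (Suc i)"
  by (rule poly_mapping_eqI) (auto simp: lookup_gins lookup_single when_def)

text \<open>At index \<open>i\<close> the left exponent is 0 and the right one is positive, while
  earlier exponents agree. These are the two monomials that enter a divided difference.\<close>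

lemma gins_shift_less: "gins i m + unit_exp (Suc i) < gins (Suc i) m + unit_exp i"
  unfolding less_gcomp_iff
  by (rule exI[of _ i]) (auto simp: lookup_gins lookup_add lookup_single when_def)

section \<open>Total degree and finiteness\<close>

lemma gdeg_eq:
  "finite A \<Longrightarrow> Poly_Mapping.keys m \<subseteq> A \<Longrightarrow> gdeg m = (\<Sum>i\<in>A. Poly_Mapping.lookup m i)"
  unfolding gdeg_def by (rule sum.mono_neutral_left) (auto simp: in_keys_iff)

lemma gdeg_add [simp]: "gdeg (m + n) = gdeg m + gdeg n"
proof -
  let ?A = "Poly_Mapping.keys m \<union> Poly_Mapping.keys n"
  have "Poly_Mapping.keys (m + n) \<subseteq> ?A" by (rule Poly_Mapping.keys_add)
  then show ?thesis
    by (subst (1 2 3) gdeg_eq[of ?A]) (auto simp: lookup_add sum.distrib)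
qed

lemma gdeg_gcons [simp]: "gdeg (gcons b m) = b + gdeg m"
proof -
  have "Poly_Mapping.keys (gcons b m) \<subseteq> insert 0 (Suc ` Poly_Mapping.keys m)"
  proof
    fix i assume "i \<in> Poly_Mapping.keys (gcons b m)"
    then show "i \<in> insert 0 (Suc ` Poly_Mapping.keys m)"
      by (cases i) (auto simp: in_keys_iff)
  qed
  then have "gdeg (gcons b m) =
      (\<Sum>i\<in>insert 0 (Suc ` Poly_Mapping.keys m). Poly_Mapping.lookup (gcons b m) i)"
    by (rule gdeg_eq[rotated]) simp
  also have "\<dots> = b + (\<Sum>i\<in>Suc ` Poly_Mapping.keys m. Poly_Mapping.lookup (gcons b m) i)"
    by (subst sum.insert) auto
  also have "(\<Sum>i\<in>Suc ` Poly_Mapping.keys m. Poly_Mapping.lookup (gcons b m) i) = gdeg m"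
    by (simp add: sum.reindex gdeg_def)
  finally show ?thesis .
qed

lemma gdeg_gins [simp]: "gdeg (gins i m) = gdeg m"
proof (induction i arbitrary: m)
  case (Suc i)
  then show ?case by (cases m rule: gcomp_cases) simp
qed simp

lemma gdeg_0 [simp]: "gdeg 0 = 0"
  and gdeg_single [simp]: "gdeg (Poly_Mapping.single i a) = a"
  by (simp_all add: gdeg_def)

lemma gdeg_eq_0_iff [simp]: "gdeg m = 0 \<longleftrightarrow> m = 0"
proof
  assume *: "gdeg m = 0"
  then have "Poly_Mapping.lookup m i = 0" if "i \<in> Poly_Mapping.keys m" for i
    using that unfolding gdeg_def by simp
  then show "m = 0"
    by (intro poly_mapping_eqI) (metis in_keys_iff lookup_zero)
qed simp

lemma finite_bounded_gcomps: "finite {m. Poly_Mapping.keys m \<subseteq> {..<n} \<and> gdeg m \<le> d}"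
proof (rule finite_subset)
  \<comment> \<open>An exponent is at most the total degree, so all monomials in question divide
    (x_0 ... x_(n-1))^d.\<close>
  let ?b = "\<Sum>i<n. Poly_Mapping.single i d"
  have b: "Poly_Mapping.lookup ?b i = (if i < n then d else 0)" for i
    by (simp add: lookup_sum lookup_single when_def)
  have le: "Poly_Mapping.lookup m i \<le> gdeg m" for m i
    unfolding gdeg_def
    by (cases "i \<in> Poly_Mapping.keys m") (auto intro: member_le_sum simp: in_keys_iff)
  show "{m. Poly_Mapping.keys m \<subseteq> {..<n} \<and> gdeg m \<le> d}
      \<subseteq> {a. \<forall>i. Poly_Mapping.lookup a i \<le> Poly_Mapping.lookup ?b i}"
    unfolding b using le by (auto simp: subset_iff in_keys_iff) (meson order_trans)
  show "finite {a. \<forall>i. Poly_Mapping.lookup a i \<le> Poly_Mapping.lookup ?b i}"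
    by (rule finite_gcomp_le)
qed

text \<open>In each row only the easternmost point matters. As indices start at 0, the sum has
  \<open>j + 1\<close> terms, so the bound j - 1 of the usual criterion becomes
  \<open>j\<close>.\<close>

lemma catalan_path_iff:
  "catalan_path \<alpha> \<longleftrightarrow> (\<forall>j. (\<Sum>i\<le>j. Poly_Mapping.lookup \<alpha> i) \<le> j)"
proof -
  have "(\<Sum>i\<le>j. Poly_Mapping.lookup \<alpha> i) =
      (\<Sum>i<j. Poly_Mapping.lookup \<alpha> i) + Poly_Mapping.lookup \<alpha> j" for j
    by (metis lessThan_Suc_atMost sum.lessThan_Suc)
  moreover have "catalan_path \<alpha> \<longleftrightarrow>
      (\<forall>y k. k \<le> Poly_Mapping.lookup \<alpha> y \<longrightarrow> (\<Sum>i<y. Poly_Mapping.lookup \<alpha> i) + k \<le> y)"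
    unfolding catalan_path_def lattice_path_def Ball_def mem_Collect_eq case_prod_unfold
    by (simp add: prod_eq_iff) (smt (verit, best) fst_conv of_nat_le_iff snd_conv)
  moreover have "(\<forall>k\<le>a. s + k \<le> j) \<longleftrightarrow> s + a \<le> j" for a s j :: nat
    by (meson add_left_mono order_refl order_trans)
  ultimately show ?thesis by simp
qed


section \<open>Fundamental quasi-symmetric functions\<close>

lemma descents_Nil [simp]: "descents [] = {}"
  by (simp add: descents_def)

lemma descents_Cons:
  "descents (a # \<alpha>) = (if \<alpha> = [] then {} else insert a ((+) a ` descents \<alpha>))"
proof -
  have ex: "(\<exists>i. P i) \<longleftrightarrow> P 0 \<or> P (Suc 0) \<or> (\<exists>i. P (Suc (Suc i)))" for P :: "nat \<Rightarrow> bool"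
    by (metis not0_implies_Suc)
  have ex': "(\<exists>i. P i) \<longleftrightarrow> P 0 \<or> (\<exists>i. P (Suc i))" for P :: "nat \<Rightarrow> bool"
    by (metis not0_implies_Suc)
  have "x \<in> descents (a # \<alpha>) \<longleftrightarrow> x \<in> (if \<alpha> = [] then {} else insert a ((+) a ` descents \<alpha>))" for x
    unfolding descents_def mem_Collect_eq
    by (subst ex) (auto simp: image_iff intro: Suc_leI dest: Suc_le_D)
  then show ?thesis by blast
qed

text \<open>Position 1 is no descent when the first part is at least 2, so the deleted first letter
  is only weakly below the next one; all descents move down by one.\<close>

lemma fundamental_indices_Suc_Cons:
  "j # js \<in> fundamental_indices (Suc (Suc a) # \<alpha>) \<longleftrightarrow>
     js \<in> fundamental_indices (Suc a # \<alpha>) \<and> j \<le> hd js"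
proof -
  have d: "Suc i \<in> descents (Suc (Suc a) # \<alpha>) \<longleftrightarrow> i \<in> descents (Suc a # \<alpha>)" for i
    by (auto simp: descents_Cons image_iff)
  have d0: "0 \<notin> descents (Suc a # \<alpha>)"
    by (auto simp: descents_Cons)
  show ?thesis
    unfolding fundamental_indices_def mem_Collect_eq
    by (subst all_nat_split; cases js) (auto simp: d d0)
qed

text \<open>Now position 1 is a descent unless the word ends there, which makes the inequality
  strict.\<close>

lemma fundamental_indices_1_Cons:
  assumes "composition \<alpha>"
  shows "j # js \<in> fundamental_indices (Suc 0 # \<alpha>) \<longleftrightarrow>
     js \<in> fundamental_indices \<alpha> \<and> (js \<noteq> [] \<longrightarrow> j < hd js)"
proof (cases "\<alpha> = []")
  case True
  then show ?thesis by (auto simp: fundamental_indices_def)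
next
  case False
  then have d: "Suc i \<in> descents (Suc 0 # \<alpha>) \<longleftrightarrow> i = 0 \<or> i \<in> descents \<alpha>" for i
    by (auto simp: descents_Cons image_iff)
  show ?thesis
    unfolding fundamental_indices_def mem_Collect_eq
    by (subst all_nat_split; cases js) (auto simp: d)
qed

lemma fundamental_indices_map_Suc [simp]:
  "map Suc js \<in> fundamental_indices \<alpha> \<longleftrightarrow> js \<in> fundamental_indices \<alpha>"
  by (auto simp: fundamental_indices_def)

lemma sorted_fundamental_indices: "js \<in> fundamental_indices \<alpha> \<Longrightarrow> sorted js"
  by (simp add: fundamental_indices_def sorted_iff_nth_Suc)

lemma word_monom_Nil [simp]: "word_monom [] = 0"
  and word_monom_Cons: "word_monom (j # js) = unit_exp j + word_monom js"
  by (simp_all add: word_monom_def)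

lemma word_monom_map_Suc: "word_monom (map Suc js) = gcons 0 (word_monom js)"
  by (induction js) (simp_all add: word_monom_Cons single_Suc_eq_gcons gcons_add)

lemma lookup_word_monom: "Poly_Mapping.lookup (word_monom js) j = count_list js j"
  by (induction js) (auto simp: word_monom_Cons lookup_add lookup_single)

text \<open>Words without the letter 0 are the shifts of arbitrary words, and shifting preserves
  weak and strict inequalities.\<close>

lemma fundamental_qsym_gcons_0 [simp]: "fundamental_qsym \<alpha> (gcons 0 m) = fundamental_qsym \<alpha> m"
proof -
  have "{js \<in> fundamental_indices \<alpha>. word_monom js = gcons 0 m} =
      map Suc ` {js \<in> fundamental_indices \<alpha>. word_monom js = m}" (is "?L = ?R")
  proof (intro equalityI subsetI)
    fix js assume js: "js \<in> ?L"
    then have "0 \<notin> set js"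
      using lookup_word_monom[of js 0] by (auto simp: count_list_0_iff)
    then have "js = map Suc (map (\<lambda>i. i - 1) js)"
      by (induction js) auto
    with js show "js \<in> ?R"
      by (metis (mono_tags, lifting) fundamental_indices_map_Suc gcons_eq_iff imageI
          mem_Collect_eq word_monom_map_Suc)
  qed (auto simp: word_monom_map_Suc)
  then show ?thesis
    unfolding fundamental_qsym_def by (simp add: card_image inj_on_def inj_map_eq_map)
qed

lemma word_monom_eq_gcons_Suc:
  assumes "sorted js" "word_monom js = gcons (Suc b) m"
  obtains js' where "js = 0 # js'" "word_monom js' = gcons b m"
proof -
  have "0 \<in> set js"
    using assms lookup_word_monom[of js 0] count_notin[of 0 js] by fastforce
  with \<open>sorted js\<close> obtain js' where js: "js = 0 # js'"
    by (cases js) auto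
  have "gcons (Suc b) m = unit_exp 0 + gcons b m"
    by (simp add: single_0_eq_gcons gcons_add)
  with js assms(2) that show ?thesis by (auto simp: word_monom_Cons)
qed

lemma word_monom_0_Cons_eq_iff [simp]:
  "word_monom (0 # js) = gcons (Suc b) m \<longleftrightarrow> word_monom js = gcons b m"
proof -
  have "gcons (Suc b) m = unit_exp 0 + gcons b m"
    by (simp add: single_0_eq_gcons gcons_add)
  then show ?thesis by (simp add: word_monom_Cons)
qed

lemma word_monom_fibre_gcons_Suc:
  assumes "\<And>js. js \<in> A \<Longrightarrow> sorted js"
  shows "{js \<in> A. word_monom js = gcons (Suc b) m} =
    Cons 0 ` {js. 0 # js \<in> A \<and> word_monom js = gcons b m}"
proof (intro equalityI subsetI)
  fix js assume js: "js \<in> {js \<in> A. word_monom js = gcons (Suc b) m}"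
  then obtain js' where "js = 0 # js'" "word_monom js' = gcons b m"
    using word_monom_eq_gcons_Suc assms by blast
  with js show "js \<in> Cons 0 ` {js. 0 # js \<in> A \<and> word_monom js = gcons b m}" by blast
qed auto

lemma fundamental_qsym_Suc_Suc:
  "fundamental_qsym (Suc (Suc a) # \<alpha>) (gcons (Suc b) m) = fundamental_qsym (Suc a # \<alpha>) (gcons b m)"
  unfolding fundamental_qsym_def
  by (subst word_monom_fibre_gcons_Suc, erule sorted_fundamental_indices)
     (simp add: card_image fundamental_indices_Suc_Cons)

text \<open>If 0 occurs in such a word, it is the first letter and the next letter is strictly
  larger. So the exponent of x_0 is exactly 1, that is \<open>b = 0\<close>.\<close>

lemma fundamental_qsym_1_Suc:
  assumes "composition \<alpha>"
  shows "fundamental_qsym (Suc 0 # \<alpha>) (gcons (Suc b) m) =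
     (if b = 0 then fundamental_qsym \<alpha> m else 0)"
proof -
  have nz: "b = 0" if "js \<in> fundamental_indices \<alpha>" "js \<noteq> [] \<longrightarrow> 0 < hd js" "word_monom js = gcons b m" for js
    using that by (cases b) (metis, metis list.distinct(1) list.sel(1) less_numeral_extra(3)
        sorted_fundamental_indices word_monom_eq_gcons_Suc)
  have hd: "0 < hd js" if "word_monom js = gcons 0 m" "js \<noteq> []" for js
    using that lookup_word_monom[of js 0] by (cases js) (auto split: if_splits)
  have "{js. 0 # js \<in> fundamental_indices (Suc 0 # \<alpha>) \<and> word_monom js = gcons b m} =
      {js \<in> fundamental_indices \<alpha>. word_monom js = gcons b m \<and> b = 0}"
    by (auto simp: fundamental_indices_1_Cons[OF assms] hd dest: nz)
  then have "card {js \<in> fundamental_indices (Suc 0 # \<alpha>). word_monom js = gcons (Suc b) m} =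
      card {js \<in> fundamental_indices \<alpha>. word_monom js = gcons b m \<and> b = 0}"
    using word_monom_fibre_gcons_Suc[of "fundamental_indices (Suc 0 # \<alpha>)" b m]
    by (simp add: card_image sorted_fundamental_indices)
  then have "fundamental_qsym (Suc 0 # \<alpha>) (gcons (Suc b) m) =
      (if b = 0 then fundamental_qsym \<alpha> (gcons 0 m) else 0)"
    by (simp add: fundamental_qsym_def)
  then show ?thesis by simp
qed

text \<open>Expansion in powers of x_0, obtained by stripping leading zeros from the words one at a
  time. The ideal arguments rest on this recursion instead of on words.\<close>

lemma fundamental_qsym_gcons:
  assumes "composition \<alpha>" "0 < a"
  shows "fundamental_qsym (a # \<alpha>) (gcons b m) =
     (if b < a then fundamental_qsym ((a - b) # \<alpha>) m
      else if b = a then fundamental_qsym \<alpha> m else 0)"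
  using assms(2)
proof (induction a arbitrary: b)
  case (Suc a)
  show ?case
  proof (cases b)
    case (Suc b')
    then show ?thesis
      using Suc.IH[of b']
      by (cases a) (auto simp: fundamental_qsym_1_Suc[OF assms(1)] fundamental_qsym_Suc_Suc)
  qed simp
qed simp

lemma fundamental_qsym_Nil: "fundamental_qsym [] m = (if m = 0 then 1 else 0)"
proof -
  have "{js \<in> fundamental_indices []. word_monom js = m} = (if m = 0 then {[]} else {})"
    by (auto simp: fundamental_indices_def)
  then show ?thesis by (simp add: fundamental_qsym_def)
qed

lemma fundamental_qsym_at_0:
  assumes "0 < sum_list \<alpha>"
  shows "fundamental_qsym \<alpha> 0 = 0"
proof -
  have "js = []" if "word_monom js = 0" for js
    using that lookup_word_monom[of js "hd js"] by (cases js) auto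
  moreover have "[] \<notin> fundamental_indices \<alpha>"
    using assms by (simp add: fundamental_indices_def del: sum_list_eq_0_iff)
  ultimately have "{js \<in> fundamental_indices \<alpha>. word_monom js = 0} = {}"
    by blast
  then show ?thesis by (simp only: fundamental_qsym_def) simp
qed

lemma composition_Cons [simp]: "composition (a # \<alpha>) \<longleftrightarrow> 0 < a \<and> composition \<alpha>"
  and composition_Nil [simp]: "composition []"
  by (auto simp: composition_def)

lemma composition_sum_list_pos: "composition \<alpha> \<Longrightarrow> 0 < sum_list \<alpha> \<longleftrightarrow> \<alpha> \<noteq> []"
  by (cases \<alpha>) auto

text \<open>Quasi-symmetry in the form needed for divided differences. Removing the first exponent
  by \<open>fundamental_qsym_gcons\<close> reduces insertion at \<open>Suc i\<close> to insertion at
  \<open>i\<close>.\<close>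

lemma fundamental_qsym_gins:
  "composition \<alpha> \<Longrightarrow> fundamental_qsym \<alpha> (gins i m) = fundamental_qsym \<alpha> m"
proof (induction i arbitrary: \<alpha> m)
  case (Suc i)
  obtain b m' where m: "m = gcons b m'" by (cases m rule: gcomp_cases)
  show ?case
  proof (cases \<alpha>)
    case Nil
    have "gins (Suc i) m = 0 \<longleftrightarrow> m = 0"
      by (metis gdeg_gins gdeg_eq_0_iff)
    with Nil show ?thesis by (simp add: fundamental_qsym_Nil)
  next
    case (Cons a \<beta>)
    with Suc m show ?thesis by (simp add: fundamental_qsym_gcons)
  qed
qed simp


section \<open>Products of power series\<close>

lemma conv_add_right: "conv f (\<lambda>m. g m + h m) = (\<lambda>m. conv f g m + conv f h m)"
  by (metis conv_add_left conv_commute)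

lemma conv_0_left [simp]: "conv (\<lambda>m. 0) f = (\<lambda>m. 0)"
  by (simp add: conv_def)

lemma conv_0_right [simp]: "conv f (\<lambda>m. 0) = (\<lambda>m. 0)"
  by (simp add: conv_def)

lemma conv_diff_left: "conv (\<lambda>m. f m - g m) h = (\<lambda>m. conv f h m - conv g h m)"
  by (rule ext) (simp add: conv_def case_prod_unfold left_diff_distrib sum_subtractf)

text \<open>The map \<phi> embeds the splittings of \<open>m\<close> into those of \<open>n\<close>,
  and the splittings missed by it contribute nothing. This serves both for setting a variable to 0
  and for splitting off the first one.\<close>

lemma conv_eq_reindex:
  assumes "inj_on \<phi> {(a, b). a + b = m}"
    and "\<phi> ` {(a, b). a + b = m} \<subseteq> {(a, b). a + b = n}"
    and "\<And>a b. a + b = n \<Longrightarrow> (a, b) \<notin> \<phi> ` {(a, b). a + b = m} \<Longrightarrow> f a * g b = 0"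
    and "\<And>a b. a + b = m \<Longrightarrow> f (fst (\<phi> (a, b))) * g (snd (\<phi> (a, b))) = f' a * g' b"
  shows "conv f g n = conv f' g' m"
proof -
  have "conv f g n = (\<Sum>p\<in>\<phi> ` {(a, b). a + b = m}. f (fst p) * g (snd p))"
    unfolding conv_def case_prod_unfold
    by (rule sum.mono_neutral_right)
       (use assms(2,3) finite_splittings[of n] in \<open>auto simp: case_prod_unfold\<close>)
  also have "\<dots> = (\<Sum>p\<in>{(a, b). a + b = m}. f (fst (\<phi> p)) * g (snd (\<phi> p)))"
    by (subst sum.reindex[OF assms(1)]) simp
  also have "\<dots> = conv f' g' m"
    unfolding conv_def by (rule sum.cong) (auto simp: assms(4))
  finally show ?thesis .
qed

text \<open>The substitution x_i = 0 is multiplicative: if x_i does not occur in a monomial, it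
  occurs in neither factor of a splitting.\<close>

lemma conv_gins: "conv f g (gins i m) = conv (\<lambda>m. f (gins i m)) (\<lambda>m. g (gins i m)) m"
proof (rule conv_eq_reindex[where \<phi> = "map_prod (gins i) (gins i)"])
  show "inj_on (map_prod (gins i) (gins i)) {(a, b). a + b = m}"
    by (auto simp: inj_on_def)
  show "map_prod (gins i) (gins i) ` {(a, b). a + b = m} \<subseteq> {(a, b). a + b = gins i m}"
    by (auto simp: gins_add)
  fix a b assume ab: "a + b = gins i m"
    and not_in: "(a, b) \<notin> map_prod (gins i) (gins i) ` {(a, b). a + b = m}"
  have "Poly_Mapping.lookup (a + b) i = 0"
    by (simp add: ab lookup_gins)
  then obtain a' b' where "a = gins i a'" "b = gins i b'"
    using gins_surj[of a i] gins_surj[of b i] by (auto simp: lookup_add)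
  with ab not_in show "f a * g b = 0"
    by (auto simp: image_iff gins_add[symmetric])
qed simp

lemma conv_monom_add [simp]: "conv (monom_series a) f (a + m) = f m"
proof -
  have "conv (monom_series a) f (a + m) = (\<Sum>p\<in>{(a, m)}. monom_series a (fst p) * f (snd p))"
    unfolding conv_def case_prod_unfold
    by (rule sum.mono_neutral_right)
       (use finite_splittings in \<open>auto simp: monom_series_def case_prod_unfold\<close>)
  then show ?thesis by (simp add: monom_series_def)
qed

lemma conv_monom_eq_0: "(\<And>n. m \<noteq> a + n) \<Longrightarrow> conv (monom_series a) f m = 0"
  unfolding conv_def by (rule sum.neutral) (auto simp: monom_series_def)

text \<open>Multiplication by a monomial only moves coefficients. Identities between divided
  differences may therefore be checked after multiplying by x_i.\<close>

lemma conv_monom_cancel: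
  assumes "conv (monom_series a) f = conv (monom_series a) g"
  shows "f = g"
proof
  fix m show "f m = g m"
    using fun_cong[OF assms, of "a + m"] by simp
qed

lemma conv_unit_exp_0 [simp]:
  "conv (monom_series (unit_exp 0)) f (gcons b m) = (case b of 0 \<Rightarrow> 0 | Suc b' \<Rightarrow> f (gcons b' m))"
proof (cases b)
  case 0
  have "gcons 0 m \<noteq> unit_exp 0 + n" for n
    by (cases n rule: gcomp_cases) (simp add: single_0_eq_gcons gcons_add)
  with 0 show ?thesis by (simp add: conv_monom_eq_0)
next
  case (Suc b')
  then have "gcons b m = unit_exp 0 + gcons b' m"
    by (simp add: single_0_eq_gcons gcons_add)
  with Suc show ?thesis by (simp only: conv_monom_add) simp
qed

section \<open>The substitution of x_(i+1) for every x_i\<close>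

definition shift_vars :: "mpseries \<Rightarrow> mpseries" where
  "shift_vars f = (\<lambda>m. if Poly_Mapping.lookup m 0 = 0 then f (gtl m) else 0)"

lemma shift_vars_gcons [simp]: "shift_vars f (gcons b m) = (if b = 0 then f m else 0)"
  by (simp add: shift_vars_def)

lemma mpseries_eqI: "(\<And>b m. f (gcons b m) = g (gcons b m)) \<Longrightarrow> f = g" for f g :: mpseries
  by (metis ext gcons_gtl)

text \<open>A factor free of x_0 acts on the coefficient of each power of x_0 separately.\<close>

lemma conv_shift_vars_gcons:
  "conv (shift_vars g) h (gcons b m) = conv g (\<lambda>m. h (gcons b m)) m"
proof (rule conv_eq_reindex[where \<phi> = "map_prod (gcons 0) (gcons b)"])
  show "inj_on (map_prod (gcons 0) (gcons b)) {(a, b). a + b = m}"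
    by (auto simp: inj_on_def)
  show "map_prod (gcons 0) (gcons b) ` {(a, b). a + b = m} \<subseteq> {(p, q). p + q = gcons b m}"
    by (auto simp: gcons_add)
  fix p q assume pq: "p + q = gcons b m"
    and not_in: "(p, q) \<notin> map_prod (gcons 0) (gcons b) ` {(a, b). a + b = m}"
  obtain c p' d q' where "p = gcons c p'" "q = gcons d q'"
    by (metis gcons_gtl)
  with pq not_in show "shift_vars g p * h q = 0"
    by (auto simp: gcons_add image_iff)
qed simp

lemma shift_vars_add: "shift_vars (\<lambda>m. f m + g m) = (\<lambda>m. shift_vars f m + shift_vars g m)"
  by (auto simp: shift_vars_def)

lemma shift_vars_conv: "shift_vars (conv f g) = conv (shift_vars f) (shift_vars g)"
  by (rule mpseries_eqI) (simp add: conv_shift_vars_gcons)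


section \<open>Ideals generated by fundamental quasi-symmetric functions of given excess\<close>

definition excess :: "nat list \<Rightarrow> nat" where
  "excess \<alpha> = (\<Sum>a\<leftarrow>\<alpha>. a - 1)"

text \<open>The ideal is built as finite sums, one summand at a time, so that linear statements
  about it reduce to multiples of a single generator. Excluding the empty composition keeps the
  constant 1 out when \<open>h = 0\<close>.\<close>

inductive_set excess_ideal :: "nat \<Rightarrow> mpseries set" for h where
  zero: "(\<lambda>m. 0) \<in> excess_ideal h"
| step: "\<lbrakk>f \<in> excess_ideal h; composition \<alpha>; \<alpha> \<noteq> []; h \<le> excess \<alpha>\<rbrakk>
    \<Longrightarrow> (\<lambda>m. f m + conv g (fundamental_qsym \<alpha>) m) \<in> excess_ideal h"

lemma excess_simps [simp]: "excess [] = 0" "excess (a # \<alpha>) = a - 1 + excess \<alpha>"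
  by (simp_all add: excess_def)

lemma conv_fundamental_in_excess_ideal:
  "\<lbrakk>composition \<alpha>; \<alpha> \<noteq> []; h \<le> excess \<alpha>\<rbrakk> \<Longrightarrow> conv g (fundamental_qsym \<alpha>) \<in> excess_ideal h"
  using excess_ideal.step[OF excess_ideal.zero, of \<alpha> h g] by simp

lemma fundamental_in_excess_ideal:
  "\<lbrakk>composition \<alpha>; \<alpha> \<noteq> []; h \<le> excess \<alpha>\<rbrakk> \<Longrightarrow> fundamental_qsym \<alpha> \<in> excess_ideal h"
  using conv_fundamental_in_excess_ideal[of \<alpha> h "const_series 1"] by (simp add: conv_const_left)

lemma excess_ideal_add:
  assumes "g \<in> excess_ideal h" "f \<in> excess_ideal h"
  shows "(\<lambda>m. f m + g m) \<in> excess_ideal h"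
  using assms(1)
proof induction
  case (step g \<alpha> k)
  from excess_ideal.step[OF step(5) step(2-4), of k] show ?case by (simp add: add.assoc)
qed (simp add: assms(2))

lemma excess_ideal_conv: "f \<in> excess_ideal h \<Longrightarrow> conv k f \<in> excess_ideal h"
proof (induction rule: excess_ideal.induct)
  case (step f \<alpha> g)
  from excess_ideal.step[OF step(5) step(2-4), of "conv k g"] show ?case
    by (simp add: conv_add_right conv_assoc)
qed (simp add: excess_ideal.zero)

lemma excess_ideal_scale: "f \<in> excess_ideal h \<Longrightarrow> (\<lambda>m. c * f m) \<in> excess_ideal h"
  using excess_ideal_conv[of f h "const_series c"] by (simp add: conv_const_left)

lemma excess_ideal_diff:
  "\<lbrakk>f \<in> excess_ideal h; g \<in> excess_ideal h\<rbrakk> \<Longrightarrow> (\<lambda>m. f m - g m) \<in> excess_ideal h"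
  using excess_ideal_add[OF excess_ideal_scale[of g h "-1"], of f] by simp

text \<open>The left sides collect the terms without x_0; by \<open>fundamental_qsym_gcons\<close>
  the remaining terms are x_0 times the series subtracted here.\<close>

lemma shift_vars_fundamental:
  assumes "composition \<alpha>"
  shows "shift_vars (fundamental_qsym (Suc 0 # \<alpha>)) = (\<lambda>m. fundamental_qsym (Suc 0 # \<alpha>) m -
      conv (monom_series (unit_exp 0)) (shift_vars (fundamental_qsym \<alpha>)) m)"
    and "shift_vars (fundamental_qsym (Suc (Suc a) # \<alpha>)) = (\<lambda>m. fundamental_qsym (Suc (Suc a) # \<alpha>) m -
      conv (monom_series (unit_exp 0)) (fundamental_qsym (Suc a # \<alpha>)) m)"
  by (rule mpseries_eqI, 
      simp add: fundamental_qsym_gcons[OF assms] conv_unit_exp_0[unfolded One_nat_def] split: nat.splits)+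

text \<open>Renumbering costs at most one unit of excess. A first part 1 has no excess, so the tail
  is covered by induction; for a larger first part the correction term has excess one less.\<close>

lemma shift_vars_fundamental_in_excess_ideal:
  "\<lbrakk>composition \<alpha>; h < excess \<alpha>\<rbrakk> \<Longrightarrow> shift_vars (fundamental_qsym \<alpha>) \<in> excess_ideal h"
proof (induction \<alpha>)
  case (Cons a \<alpha>)
  then have \<alpha>: "composition \<alpha>" by simp
  consider "a = Suc 0" | a' where "a = Suc (Suc a')"
    using Cons.prems by (metis composition_Cons gr0_implies_Suc not0_implies_Suc)
  then show ?case
  proof cases
    case 1
    with Cons show ?thesis
      by (simp add: shift_vars_fundamental(1)[OF \<alpha>])
         (intro excess_ideal_diff fundamental_in_excess_ideal excess_ideal_conv; simp)
  next
    case 2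
    with Cons.prems show ?thesis
      by (simp add: shift_vars_fundamental(2)[OF \<alpha>])
         (intro excess_ideal_diff fundamental_in_excess_ideal excess_ideal_conv; simp)
  qed
qed simp

lemma shift_vars_in_excess_ideal: "f \<in> excess_ideal (Suc h) \<Longrightarrow> shift_vars f \<in> excess_ideal h"
proof (induction rule: excess_ideal.induct)
  case zero
  have "shift_vars (\<lambda>m. 0) = (\<lambda>m. 0)" by (simp add: shift_vars_def)
  then show ?case by (simp add: excess_ideal.zero)
next
  case (step f \<alpha> g)
  then show ?case
    unfolding shift_vars_add shift_vars_conv
    by (intro excess_ideal_add excess_ideal_conv shift_vars_fundamental_in_excess_ideal) auto
qed

text \<open>The series \<open>G\<close> becomes the coefficient of the highest power of x_0. For
  \<open>a > 0\<close> prefix the part \<open>a\<close> to each generator: its top term is x_0^a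
  times the shifted old generator, and its excess is at least (a - 1) + (h + 1 - a) = h. For
  \<open>a = 0\<close> renumbering does it, and the level \<open>Suc h\<close> pays for the lost
  unit.\<close>

lemma excess_ideal_lift:
  assumes "a \<le> h" "G \<in> excess_ideal (Suc h - a)"
  shows "\<exists>H\<in>excess_ideal h. (\<forall>m. H (gcons a m) = G m) \<and> (\<forall>b m. a < b \<longrightarrow> H (gcons b m) = 0)"
proof (cases "a = 0")
  case True
  with assms show ?thesis
    by (intro bexI[of _ "shift_vars G"] shift_vars_in_excess_ideal) auto
next
  case False
  from assms(2) show ?thesis
  proof induction
    case zero
    then show ?case by (intro bexI[OF _ excess_ideal.zero]) auto
  next
    case (step G \<alpha> g)
    then obtain H where H: "H \<in> excess_ideal h" "\<And>m. H (gcons a m) = G m"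
      "\<And>b m. a < b \<Longrightarrow> H (gcons b m) = 0" by blast
    have "(\<lambda>m. H m + conv (shift_vars g) (fundamental_qsym (a # \<alpha>)) m) \<in> excess_ideal h"
      using False step(2-4) assms(1) by (intro excess_ideal.step[OF H(1)]) auto
    then show ?case
      by (rule bexI[rotated])
         (use False in \<open>simp add: H conv_shift_vars_gcons fundamental_qsym_gcons[OF step(2)]\<close>)
  qed
qed

text \<open>Either the first exponent exceeds \<open>h\<close> and a one-part generator suffices, or
  it is split off and the tail is lifted. The level \<open>h\<close> varies in the induction because
  the tail needs a different one.\<close>

lemma excess_ideal_leading_monomial:
  assumes "Suc j + h \<le> (\<Sum>i\<le>j. Poly_Mapping.lookup \<epsilon> i)"
  shows "\<exists>G\<in>excess_ideal h. G \<epsilon> = 1 \<and> (\<forall>m>\<epsilon>. G m = 0)"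
  using assms
proof (induction j arbitrary: h \<epsilon>)
  have first: "\<exists>G\<in>excess_ideal h. G \<epsilon> = 1 \<and> (\<forall>m>\<epsilon>. G m = 0)"
    if "Suc h \<le> Poly_Mapping.lookup \<epsilon> 0" for h \<epsilon>
  proof -
    \<comment> \<open>The quotient of \<epsilon> by x_0^(h+1), which is the leading monomial of the
      generator for \<open>[Suc h]\<close>; adding \<open>n\<close> preserves the order.\<close>
    define n where "n = gcons (Poly_Mapping.lookup \<epsilon> 0 - Suc h) (gtl \<epsilon>)"
    have \<epsilon>: "\<epsilon> = n + gcons (Suc h) 0"
      using that gcons_gtl[of \<epsilon>] by (simp add: n_def gcons_add del: gcons_gtl)
    define G where "G = conv (monom_series n) (fundamental_qsym [Suc h])"
    have "G \<in> excess_ideal h"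
      unfolding G_def by (rule conv_fundamental_in_excess_ideal) auto
    moreover have "G \<epsilon> = 1"
      by (simp add: G_def \<epsilon> fundamental_qsym_gcons fundamental_qsym_Nil)
    moreover have "G m = 0" if "\<epsilon> < m" for m
    proof (cases "\<exists>x. m = n + x")
      case True
      then obtain x where x: "m = n + x" by blast
      obtain b x' where x': "x = gcons b x'" by (cases x rule: gcomp_cases)
      from that have "gcons (Suc h) 0 < x" by (simp add: x \<epsilon>)
      then show ?thesis
        by (auto simp: G_def x x' fundamental_qsym_gcons fundamental_qsym_Nil)
    qed (simp add: G_def conv_monom_eq_0)
    ultimately show ?thesis by blast
  qed
  {
    case 0
    then show ?case by (intro first) simp
  next
    case (Suc j)
    show ?case
    proof (cases "Suc h \<le> Poly_Mapping.lookup \<epsilon> 0")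
      case False
      obtain a \<epsilon>' where \<epsilon>: "\<epsilon> = gcons a \<epsilon>'" by (cases \<epsilon> rule: gcomp_cases)
      \<comment> \<open>Dropping the first variable removes \<open>a\<close> from the sum and one
        row. Since \<open>a \<le> h\<close>, the subtraction is not truncated.\<close>
      have "Suc j + (Suc h - a) \<le> (\<Sum>i\<le>j. Poly_Mapping.lookup \<epsilon>' i)"
        using Suc.prems False by (simp add: \<epsilon> sum.atMost_Suc_shift del: sum.atMost_Suc)
      from Suc.IH[OF this] obtain G where G: "G \<in> excess_ideal (Suc h - a)" "G \<epsilon>' = 1"
        "\<forall>m>\<epsilon>'. G m = 0" by blast
      obtain H where H: "H \<in> excess_ideal h" "\<And>m. H (gcons a m) = G m"
        "\<And>b m. a < b \<Longrightarrow> H (gcons b m) = 0"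
        using excess_ideal_lift[OF _ G(1)] False by (auto simp: \<epsilon>)
      have "H m = 0" if "\<epsilon> < m" for m
        using that H G(3) by (cases m rule: gcomp_cases) (auto simp: \<epsilon>)
      moreover have "H \<epsilon> = 1"
        by (simp add: \<epsilon> H(2) G(2))
      ultimately show ?thesis using H(1) by blast
    qed (rule first)
  }
qed

lemma ideal_excess_ideal: "ideal (excess_ideal h) PS"
proof -
  interpret cring PS by (rule PS_cring)
  show ?thesis
  proof (rule idealI)
    show "ring PS" by (rule ring_axioms)
    show "subgroup (excess_ideal h) (add_monoid PS)"
    proof (rule add.subgroupI)
      show "excess_ideal h \<subseteq> carrier PS" by (simp add: PS_def)
      show "excess_ideal h \<noteq> {}" using excess_ideal.zero by blast
      show "\<ominus>\<^bsub>PS\<^esub> a \<in> excess_ideal h" if "a \<in> excess_ideal h" for a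
      proof -
        have "\<ominus>\<^bsub>PS\<^esub> a = (\<lambda>m. - 1 * a m)"
          by (rule sum_zero_eq_neg[symmetric]) (auto simp: PS_def)
        with that show ?thesis by (simp only: excess_ideal_scale)
      qed
      show "a \<oplus>\<^bsub>PS\<^esub> b \<in> excess_ideal h" if "a \<in> excess_ideal h" "b \<in> excess_ideal h" for a b
        using excess_ideal_add[OF that(2,1)] by (simp add: PS_def)
    qed
    show "x \<otimes>\<^bsub>PS\<^esub> a \<in> excess_ideal h" if "a \<in> excess_ideal h" for a x
      using excess_ideal_conv[OF that] by (simp add: PS_def)
    then show "a \<otimes>\<^bsub>PS\<^esub> x \<in> excess_ideal h" if "a \<in> excess_ideal h" for a x
      using that by (simp add: PS_def conv_commute)
  qed
qed

text \<open>At level 0 the excess condition is void, so all nonempty compositions supply generators,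
  and taking their linear span does not enlarge the ideal.\<close>

lemma J_ideal_eq: "J_ideal = excess_ideal 0"
proof
  interpret cring PS by (rule PS_cring)
  show "J_ideal \<subseteq> excess_ideal 0"
    unfolding J_ideal_def
  proof (rule genideal_minimal[OF ideal_excess_ideal])
    have "(\<lambda>m. \<Sum>f\<in>S. c f * f m) \<in> excess_ideal 0"
      if "finite S" "S \<subseteq> fundamental_qsym ` {\<alpha>. composition \<alpha> \<and> 0 < sum_list \<alpha>}" for S c
      using that
    proof induction
      case empty
      then show ?case by (simp add: excess_ideal.zero)
    next
      case (insert f S)
      then have "f \<in> excess_ideal 0"
        by (auto intro!: fundamental_in_excess_ideal)
      then show ?case
        using insert by (simp add: excess_ideal_add excess_ideal_scale)
    qed
    then show "nonconst_qsym \<subseteq> excess_ideal 0"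
      unfolding nonconst_qsym_def lin_span_def by blast
  qed
  interpret J: ideal J_ideal PS by (rule J_ideal_ideal)
  have F: "fundamental_qsym \<alpha> \<in> J_ideal" if "composition \<alpha>" "\<alpha> \<noteq> []" for \<alpha>
  proof -
    have "fundamental_qsym \<alpha> \<in> nonconst_qsym"
      unfolding nonconst_qsym_def lin_span_def mem_Collect_eq
      using that composition_sum_list_pos[OF that(1)]
      by (intro exI[of _ "{fundamental_qsym \<alpha>}"] exI[of _ "\<lambda>_. 1"]) auto
    then show ?thesis
      unfolding J_ideal_def using genideal_self[of nonconst_qsym] by (auto simp: PS_def)
  qed
  show "excess_ideal 0 \<subseteq> J_ideal"
  proof
    fix f assume "f \<in> excess_ideal 0"
    then show "f \<in> J_ideal"
    proof induction
      case zero
      show ?case using J.zero_closed by (simp add: PS_def)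
    next
      case (step f \<alpha> g)
      then have "conv g (fundamental_qsym \<alpha>) \<in> J_ideal"
        using J.I_l_closed[OF F, of \<alpha> g] by (simp add: PS_def)
      with step show ?case
        using J.a_closed[of f "conv g (fundamental_qsym \<alpha>)"] by (simp add: PS_def)
    qed
  qed
qed


section \<open>Vanishing of elements of the ideal\<close>

text \<open>
  The divided difference of \<open>f(x_0, ..., x_i, 0, x_(i+1), ...)\<close> and
  \<open>f(x_0, ..., x_(i-1), 0, x_i, ...)\<close> by \<open>x_i\<close>. Quasi-symmetric functions
  are invariant under the insertion of zeros, so that it is linear over them.
\<close>

definition diff_quot :: "nat \<Rightarrow> mpseries \<Rightarrow> mpseries" where
  "diff_quot i f = (\<lambda>m. f (gins (Suc i) m + unit_exp i) - f (gins i m + unit_exp (Suc i)))"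

text \<open>The two insertions agree on monomials without x_i, so the difference is divisible by
  x_i. On x_i times \<open>n\<close> they give x_i and x_(i+1) times the insertions of
  \<open>n\<close>, which explains the formula for \<open>diff_quot\<close>.\<close>

lemma conv_unit_exp_diff_quot:
  "conv (monom_series (unit_exp i)) (diff_quot i f) = (\<lambda>m. f (gins (Suc i) m) - f (gins i m))"
proof
  fix m
  show "conv (monom_series (unit_exp i)) (diff_quot i f) m = f (gins (Suc i) m) - f (gins i m)"
  proof (cases "Poly_Mapping.lookup m i = 0")
    case True
    then have "m \<noteq> unit_exp i + n" for n
      by (metis add_is_0 lookup_add lookup_single_eq one_neq_zero)
    then have "conv (monom_series (unit_exp i)) (diff_quot i f) m = 0"
      by (rule conv_monom_eq_0)
    with True show ?thesis by (simp add: gins_eq_gins_Suc)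
  next
    case False
    then have m: "m = unit_exp i + (m - unit_exp i)"
      by (intro poly_mapping_eqI) (auto simp: lookup_add lookup_minus lookup_single when_def)
    define n where "n = m - unit_exp i"
    from m have "m = unit_exp i + n" by (simp add: n_def)
    then show ?thesis
      by (simp only: conv_monom_add gins_add gins_Suc_single gins_single)
         (simp add: diff_quot_def add.commute)
  qed
qed

text \<open>Both substitutions are multiplicative and fix \<open>F\<close>, so \<open>F\<close>
  factors out of their difference; then x_i is cancelled.\<close>

lemma diff_quot_conv:
  assumes "\<And>i m. F (gins i m) = F m"
  shows "diff_quot i (conv g F) = conv (diff_quot i g) F"
proof (rule conv_monom_cancel)
  let ?X = "monom_series (unit_exp i)"
  have "conv ?X (diff_quot i (conv g F)) = conv (conv ?X (diff_quot i g)) F"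
    by (simp only: conv_unit_exp_diff_quot conv_gins assms conv_diff_left)
  then show "conv ?X (diff_quot i (conv g F)) = conv ?X (conv (diff_quot i g) F)"
    by (simp only: conv_assoc)
qed

lemma diff_quot_in_excess_ideal: "f \<in> excess_ideal h \<Longrightarrow> diff_quot i f \<in> excess_ideal h"
proof (induction rule: excess_ideal.induct)
  case zero
  then show ?case by (simp add: diff_quot_def excess_ideal.zero)
next
  case (step f \<alpha> g)
  have "diff_quot i (\<lambda>m. f m + conv g (fundamental_qsym \<alpha>) m) =
      (\<lambda>m. diff_quot i f m + diff_quot i (conv g (fundamental_qsym \<alpha>)) m)"
    by (auto simp: diff_quot_def)
  with step show ?case
    by (simp add: diff_quot_conv fundamental_qsym_gins excess_ideal.step)
qed

lemma excess_ideal_at_0: "f \<in> excess_ideal h \<Longrightarrow> f 0 = 0"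
proof (induction rule: excess_ideal.induct)
  case (step f \<alpha> g)
  have "b = 0" if "a + b = 0" for a b :: gcomp
    using that by (metis add_is_0 gdeg_add gdeg_eq_0_iff)
  then have "conv g (fundamental_qsym \<alpha>) 0 = 0"
    unfolding conv_def using step(3) composition_sum_list_pos[OF step(2)] fundamental_qsym_at_0[of \<alpha>]
    by (intro sum.neutral) fastforce
  with step show ?case by simp
qed simp

lemma sum_lookup_gins:
  "k \<le> Suc j \<Longrightarrow> (\<Sum>i\<le>Suc j. Poly_Mapping.lookup (gins k m) i) = (\<Sum>i\<le>j. Poly_Mapping.lookup m i)"
proof (induction j)
  case 0
  then show ?case by (cases k) (auto simp: lookup_gins)
next
  case (Suc j)
  show ?case
  proof (cases "k = Suc (Suc j)")
    case True
    then have "(\<Sum>i\<le>Suc (Suc j). Poly_Mapping.lookup (gins k m) i) =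
        (\<Sum>i\<le>Suc j. Poly_Mapping.lookup (gins k m) i)"
      by (simp add: lookup_gins)
    also have "\<dots> = (\<Sum>i\<le>Suc j. Poly_Mapping.lookup m i)"
      using True by (intro sum.cong) (auto simp: lookup_gins)
    finally show ?thesis .
  next
    case False
    with Suc.prems have "k \<le> Suc j" by simp
    with Suc.IH[OF this] show ?thesis by (simp add: lookup_gins)
  qed
qed

lemma keys_subset_lessThan_iff:
  "Poly_Mapping.keys m \<subseteq> {..<n} \<longleftrightarrow> (\<forall>i\<ge>n. Poly_Mapping.lookup m i = 0)"
  for m :: gcomp
  unfolding subset_iff lessThan_iff in_keys_iff by (metis not_less)

text \<open>Lower the first positive exponent by one and delete the zero just before it, which
  exists since a Catalan path starts with exponent 0. Prefix sums before that place are 0; later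
  ones lose one unit and one row. The result has the shape of the smaller monomial in
  \<open>diff_quot k\<close>.\<close>

lemma catalan_path_decompose:
  assumes "catalan_path \<epsilon>" "\<epsilon> \<noteq> 0"
  obtains k \<epsilon>' where "\<epsilon> = gins k \<epsilon>' + unit_exp (Suc k)" "catalan_path \<epsilon>'"
proof -
  define p where "p = (LEAST i. Poly_Mapping.lookup \<epsilon> i \<noteq> 0)"
  from \<open>\<epsilon> \<noteq> 0\<close> have "\<exists>i. Poly_Mapping.lookup \<epsilon> i \<noteq> 0"
    by (auto simp: gcomp_eq_iff)
  then have p: "Poly_Mapping.lookup \<epsilon> p \<noteq> 0"
    unfolding p_def by (rule LeastI_ex)
  have less_p: "Poly_Mapping.lookup \<epsilon> i = 0" if "i < p" for i
    using that not_less_Least unfolding p_def by blast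
  have "Poly_Mapping.lookup \<epsilon> 0 = 0"
    using assms(1) by (auto simp: catalan_path_iff dest: spec[of _ 0])
  with p obtain k where k: "p = Suc k" by (cases p) auto
  have \<epsilon>: "\<epsilon> = (\<epsilon> - unit_exp (Suc k)) + unit_exp (Suc k)"
    using p k by (intro poly_mapping_eqI) (auto simp: lookup_add lookup_minus lookup_single when_def)
  have "Poly_Mapping.lookup (\<epsilon> - unit_exp (Suc k)) k = 0"
    using less_p k by (simp add: lookup_minus)
  then obtain \<epsilon>' where "\<epsilon> - unit_exp (Suc k) = gins k \<epsilon>'"
    using gins_surj by blast
  with \<epsilon> have eq: "\<epsilon> = gins k \<epsilon>' + unit_exp (Suc k)" by simp
  have "catalan_path \<epsilon>'"
    unfolding catalan_path_iff
  proof
    fix j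
    show "(\<Sum>i\<le>j. Poly_Mapping.lookup \<epsilon>' i) \<le> j"
    proof (cases "j < k")
      case True
      have "Poly_Mapping.lookup \<epsilon>' i = 0" if "i \<le> j" for i
        using less_p[of i] that True k by (simp add: eq lookup_add lookup_gins split: if_splits)
      then show ?thesis by simp
    next
      case False
      have "(\<Sum>i\<le>Suc j. Poly_Mapping.lookup \<epsilon> i) \<le> Suc j"
        using assms(1) unfolding catalan_path_iff by blast
      also have "(\<Sum>i\<le>Suc j. Poly_Mapping.lookup \<epsilon> i) =
          (\<Sum>i\<le>j. Poly_Mapping.lookup \<epsilon>' i) + (\<Sum>i\<le>Suc j. Poly_Mapping.lookup (unit_exp (Suc k)) i)"
        using False by (simp only: eq lookup_add sum.distrib) (subst sum_lookup_gins; simp)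
      also have "(\<Sum>i\<le>Suc j. Poly_Mapping.lookup (unit_exp (Suc k)) i) = 1"
        using False by (simp add: lookup_single when_def del: sum.atMost_Suc)
      finally show ?thesis by simp
    qed
  qed
  with eq that show ?thesis by blast
qed

text \<open>Induction on the degree: \<open>diff_quot k f\<close> lies in the ideal and satisfies
  the hypotheses for \<epsilon>', with one degree and one variable less. Degree and variables are
  bounded so that only finitely many coefficients are involved.\<close>

lemma excess_ideal_vanish_at_catalan_path:
  assumes "f \<in> excess_ideal 0" "catalan_path \<epsilon>" "Poly_Mapping.keys \<epsilon> \<subseteq> {..<n}"
    and "\<And>m. \<lbrakk>\<epsilon> < m; gdeg m = gdeg \<epsilon>; Poly_Mapping.keys m \<subseteq> {..<n}\<rbrakk> \<Longrightarrow> f m = 0"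
  shows "f \<epsilon> = 0"
  using assms
proof (induction "gdeg \<epsilon>" arbitrary: f \<epsilon> n)
  case 0
  then show ?case by (simp add: excess_ideal_at_0)
next
  case (Suc d)
  then have "\<epsilon> \<noteq> 0" by auto
  then obtain k \<epsilon>' where \<epsilon>: "\<epsilon> = gins k \<epsilon>' + unit_exp (Suc k)" and \<epsilon>': "catalan_path \<epsilon>'"
    using catalan_path_decompose[OF Suc.prems(2)] by metis
  have n: "Poly_Mapping.lookup \<epsilon> i = 0" if "n \<le> i" for i
    using Suc.prems(3) that by (simp add: keys_subset_lessThan_iff)
  have k: "Suc k < n"
    using n[of "Suc k"] by (cases "n \<le> Suc k") (auto simp: \<epsilon> lookup_add)
  have keys': "Poly_Mapping.keys \<epsilon>' \<subseteq> {..<n - 1}"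
    unfolding keys_subset_lessThan_iff
  proof (intro allI impI)
    fix i assume "n - 1 \<le> i"
    with k n[of "Suc i"] show "Poly_Mapping.lookup \<epsilon>' i = 0"
      by (simp add: \<epsilon> lookup_add lookup_gins split: if_splits)
  qed
  \<comment> \<open>For \<open>\<epsilon>' \<le> m\<close>, each monomial entering
    \<open>diff_quot k f m\<close> other than \<epsilon> itself is larger than \<epsilon>, as
    insertion preserves the order and by \<open>gins_shift_less\<close>.\<close>
  have zero: "f (gins (Suc k) m + unit_exp k) = 0" "\<epsilon>' < m \<Longrightarrow> f (gins k m + unit_exp (Suc k)) = 0"
    if "\<epsilon>' \<le> m" "gdeg m = gdeg \<epsilon>'" "Poly_Mapping.keys m \<subseteq> {..<n - 1}" for m
  proof -
    have le: "\<epsilon> \<le> gins k m + unit_exp (Suc k)"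
      using that(1) by (auto simp: \<epsilon> le_less)
    have keys: "Poly_Mapping.keys (gins (Suc k) m + unit_exp k) \<subseteq> {..<n}"
      "Poly_Mapping.keys (gins k m + unit_exp (Suc k)) \<subseteq> {..<n}"
      using that(3) k unfolding keys_subset_lessThan_iff
      by (auto simp: lookup_add lookup_gins lookup_single when_def)
    show "f (gins (Suc k) m + unit_exp k) = 0"
      using that keys le_less_trans[OF le gins_shift_less] by (intro Suc.prems(4)) (auto simp: \<epsilon>)
    show "f (gins k m + unit_exp (Suc k)) = 0" if "\<epsilon>' < m"
      using that keys \<open>gdeg m = _\<close> by (intro Suc.prems(4)) (auto simp: \<epsilon>)
  qed
  have "diff_quot k f \<epsilon>' = 0"
  proof (rule Suc.hyps(1)[OF _ diff_quot_in_excess_ideal[OF Suc.prems(1)] \<epsilon>' keys'])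
    show "d = gdeg \<epsilon>'" using Suc.hyps(2) by (simp add: \<epsilon>)
    show "diff_quot k f m = 0"
      if "\<epsilon>' < m" "gdeg m = gdeg \<epsilon>'" "Poly_Mapping.keys m \<subseteq> {..<n - 1}" for m
      using that zero[of m] by (simp add: diff_quot_def)
  qed
  \<comment> \<open>At \<epsilon>' the first coefficient of the divided difference vanishes and the
    second is that of \<open>f\<close> at \<epsilon>.\<close>
  then show ?case
    using zero(1)[of \<epsilon>'] keys' by (simp add: diff_quot_def \<epsilon>)
qed

section \<open>Finite boxes of monomials: uniqueness and interpolation\<close>

definition gbox :: "nat \<Rightarrow> gcomp set" where
  "gbox n = {m. Poly_Mapping.keys m \<subseteq> {..<n} \<and> gdeg m \<le> n}"

lemma finite_gbox [simp]: "finite (gbox n)"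
  unfolding gbox_def by (rule finite_bounded_gcomps)

lemma gbox_mono: "n \<le> k \<Longrightarrow> gbox n \<subseteq> gbox k"
  by (fastforce simp: gbox_def)

lemma finite_subset_gbox: "finite M \<Longrightarrow> \<exists>n. M \<subseteq> gbox n"
proof (induction rule: finite_induct)
  case (insert m M)
  then obtain n where n: "M \<subseteq> gbox n" by blast
  obtain k where k: "Poly_Mapping.keys m \<subseteq> {..<k}"
    using finite_nat_bounded[OF finite_keys] by blast
  have "m \<in> gbox (max k (gdeg m))"
    using k by (auto simp: gbox_def)
  then have "insert m M \<subseteq> gbox (max n (max k (gdeg m)))"
    using n gbox_mono by (meson insert_subset max.cobounded1 max.cobounded2 order_trans subsetD)
  then show ?case by blast
qed simp

text \<open>The largest monomial of the box with nonzero coefficient would be Catalan. Larger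
  monomials of the same degree in the same variables stay in the box, so the previous vanishing
  result applies to it.\<close>

lemma excess_ideal_eq_0_on_gbox:
  assumes f: "f \<in> excess_ideal 0"
    and zero: "\<And>m. \<lbrakk>m \<in> gbox n; \<not> catalan_path m\<rbrakk> \<Longrightarrow> f m = 0"
    and "m \<in> gbox n"
  shows "f m = 0"
proof (rule ccontr)
  assume "f m \<noteq> 0"
  define B where "B = {m \<in> gbox n. f m \<noteq> 0}"
  have "finite B" "B \<noteq> {}"
    using \<open>m \<in> gbox n\<close> \<open>f m \<noteq> 0\<close> by (auto simp: B_def)
  then have max: "Max B \<in> B" "\<And>x. x \<in> B \<Longrightarrow> x \<le> Max B"
    by simp_all
  have "f (Max B) = 0"
  proof (rule excess_ideal_vanish_at_catalan_path[OF f])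
    show "catalan_path (Max B)" using zero max(1) by (auto simp: B_def)
    show "Poly_Mapping.keys (Max B) \<subseteq> {..<n}" using max(1) by (auto simp: B_def gbox_def)
    fix x assume "Max B < x" "gdeg x = gdeg (Max B)" "Poly_Mapping.keys x \<subseteq> {..<n}"
    then show "f x = 0"
      using max(1) max(2)[of x] by (force simp: B_def gbox_def)
  qed
  with max(1) show False by (simp add: B_def)
qed

text \<open>Triangular elimination from the largest monomial down: the correction at
  \<open>b\<close> has leading monomial \<open>b\<close> and leaves the values at larger monomials
  unchanged.\<close>

lemma excess_ideal_interpolate:
  assumes "finite B" "\<forall>m\<in>B. \<not> catalan_path m"
  shows "\<exists>h\<in>excess_ideal 0. \<forall>m\<in>B. h m = f m"
  using assms
proof (induction rule: finite_linorder_min_induct)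
  case empty
  then show ?case using excess_ideal.zero by blast
next
  case (insert b A)
  then obtain h where h: "h \<in> excess_ideal 0" "\<forall>m\<in>A. h m = f m" by auto
  \<comment> \<open>A violation of the Catalan condition in row \<open>j\<close> is the
    leading-monomial condition at level 0.\<close>
  obtain j where "Suc j + 0 \<le> (\<Sum>i\<le>j. Poly_Mapping.lookup b i)"
    using insert.prems by (auto simp: catalan_path_iff not_le Suc_le_eq)
  then obtain G where G: "G \<in> excess_ideal 0" "G b = 1" "\<forall>m>b. G m = 0"
    using excess_ideal_leading_monomial by blast
  have "(\<lambda>m. h m + (f b - h b) * G m) \<in> excess_ideal 0"
    by (intro excess_ideal_add[OF excess_ideal_scale] G h)
  then show ?case
    by (rule bexI[rotated]) (use h G insert.hyps in auto)
qed

section \<open>Convergence in the quotient ring\<close>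

text \<open>Interpolate \<open>f\<close> at the non-Catalan monomials of each box. By uniqueness the
  interpolants are compatible, so they converge coefficientwise to some \<open>g\<close> in the
  closed ideal, and \<open>c\<close> is f - g.\<close>

lemma catalan_normal_form:
  "\<exists>c. (\<forall>m. \<not> catalan_path m \<longrightarrow> c m = 0) \<and> (\<lambda>m. c m - f m) \<in> J_closure"
proof -
  have "\<exists>h\<in>excess_ideal 0. \<forall>m\<in>{m \<in> gbox n. \<not> catalan_path m}. h m = f m" for n
    by (rule excess_ideal_interpolate) auto
  then have "\<forall>n. \<exists>h. h \<in> excess_ideal 0 \<and> (\<forall>m\<in>gbox n. \<not> catalan_path m \<longrightarrow> h m = f m)"
    by blast
  from choice[OF this] obtain h where h: "\<And>n. h n \<in> excess_ideal 0"
    and hf: "\<And>n m. \<lbrakk>m \<in> gbox n; \<not> catalan_path m\<rbrakk> \<Longrightarrow> h n m = f m"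
    by blast
  have agree: "h n m = h k m" if "n \<le> k" "m \<in> gbox n" for n k m
  proof -
    have "(\<lambda>m. h n m - h k m) \<in> excess_ideal 0"
      by (rule excess_ideal_diff[OF h h])
    moreover have "h n x - h k x = 0" if "x \<in> gbox n" "\<not> catalan_path x" for x
      using hf[OF that] hf[of x k] that gbox_mono[OF \<open>n \<le> k\<close>] by auto
    ultimately have "h n m - h k m = 0"
      using \<open>m \<in> gbox n\<close> by (rule excess_ideal_eq_0_on_gbox)
    then show ?thesis by simp
  qed
  \<comment> \<open>By \<open>agree\<close> the value does not depend on the chosen box containing
    \<open>m\<close>.\<close>
  define g where "g m = h (SOME n. m \<in> gbox n) m" for m
  have g: "g m = h n m" if "m \<in> gbox n" for m n
  proof -
    define k where "k = (SOME n. m \<in> gbox n)"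
    have "m \<in> gbox k" unfolding k_def using that by (rule someI)
    then have "h k m = h n m"
      using agree that by (metis nat_le_linear)
    then show ?thesis by (simp add: g_def k_def)
  qed
  have "(\<lambda>m. - g m) \<in> J_closure"
    unfolding J_closure_def in_closure_PS
  proof (intro allI impI)
    fix M :: "gcomp set" assume "finite M"
    then obtain n where n: "M \<subseteq> gbox n" using finite_subset_gbox by blast
    have "(\<lambda>m. - h n m) \<in> J_ideal"
      using excess_ideal_scale[OF h, of "-1" n] by (simp add: J_ideal_eq)
    moreover have "\<forall>m\<in>M. - h n m = - g m"
      using n g[of _ n] by auto
    ultimately show "\<exists>k\<in>J_ideal. \<forall>m\<in>M. k m = - g m"
      by (intro bexI[of _ "\<lambda>m. - h n m"])
  qed
  moreover have "f m - g m = 0" if "\<not> catalan_path m" for m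
  proof -
    obtain n where "m \<in> gbox n" using finite_subset_gbox[of "{m}"] by auto
    with that show ?thesis by (simp add: g[of m n] hf)
  qed
  ultimately show ?thesis
    by (intro exI[of _ "\<lambda>m. f m - g m"]) simp
qed

lemma PS_minus: "f \<ominus>\<^bsub>PS\<^esub> g = (\<lambda>m. f m - g m)"
proof -
  interpret cring PS by (rule PS_cring)
  have "\<ominus>\<^bsub>PS\<^esub> g = (\<lambda>m. - g m)"
    by (rule sum_zero_eq_neg[symmetric]) (auto simp: PS_def)
  then show ?thesis by (simp add: a_minus_def) (simp add: PS_def)
qed

lemma R_class_eq_iff: "R_class f = R_class g \<longleftrightarrow> (\<lambda>m. f m - g m) \<in> J_closure"
proof -
  interpret cring PS by (rule PS_cring)
  show ?thesis
    unfolding R_class_def PS_minus[symmetric]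
    by (rule quotient_eq_iff_same_a_r_cos[OF J_closure_ideal, symmetric]) (auto simp: PS_def)
qed

lemma R_class_surj: "r \<in> carrier R_ring \<Longrightarrow> \<exists>f. r = R_class f"
  by (auto simp: R_ring_def R_class_def FactRing_def A_RCOSETS_def')

lemma R_class_in_carrier [simp]: "R_class f \<in> carrier R_ring"
  using ring_hom_closed[OF R_class_hom] by (simp add: PS_def)

text \<open>Partial sums in the quotient lift to truncations of the coefficient function, which
  allows limits to be treated on representatives.\<close>

lemma R_class_sum_monom:
  assumes "finite S"
  shows "(\<Oplus>\<^bsub>R_ring\<^esub>i\<in>S. R_class (const_series (c i)) \<otimes>\<^bsub>R_ring\<^esub> R_class (monom_series i)) =
    R_class (\<lambda>m. if m \<in> S then c m else 0)"
proof -
  interpret R: cring R_ring by (rule R_ring_cring)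
  interpret P: cring PS by (rule PS_cring)
  have mult: "R_class f \<otimes>\<^bsub>R_ring\<^esub> R_class g = R_class (conv f g)" for f g
    using ring_hom_mult[OF R_class_hom, of f g] by (simp add: PS_def)
  have add: "R_class f \<oplus>\<^bsub>R_ring\<^esub> R_class g = R_class (\<lambda>m. f m + g m)" for f g
    using ring_hom_add[OF R_class_hom, of f g] by (simp add: PS_def)
  have zero: "R_class (\<lambda>m. 0) = \<zero>\<^bsub>R_ring\<^esub>"
    using ring_hom_zero[OF R_class_hom P.ring_axioms R.ring_axioms] by (simp add: PS_def)
  show ?thesis
    using assms
  proof induction
    case empty
    then show ?case by (simp add: zero)
  next
    case (insert i S)
    then have "(\<lambda>m. (if m = i then c i else 0) + (if m \<in> S then c m else 0)) =
        (\<lambda>m. if m \<in> insert i S then c m else 0)"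
      by auto
    moreover have "conv (const_series (c i)) (monom_series i) = (\<lambda>m. if m = i then c i else 0)"
      by (auto simp: conv_const_left monom_series_def)
    ultimately show ?case
      using insert by (simp add: mult add)
  qed
qed

lemma limitin_partial_sums:
  assumes "\<And>m. m \<notin> A \<Longrightarrow> c m = 0"
  shows "limitin PS_topology (\<lambda>S m. if m \<in> S then c m else 0) c (finite_subsets_at_top A)"
proof -
  have "\<forall>\<^sub>F S in finite_subsets_at_top A. (if m \<in> S then c m else 0) = c m" for m
    unfolding eventually_finite_subsets_at_top
    by (intro exI[of _ "{m} \<inter> A"]) (use assms in auto)
  then show ?thesis
    unfolding PS_topology_def limitin_componentwise
    by (auto intro!: limitin_eventually)
qed

text \<open>Quotient convergence is tested on the image of \<open>V\<close>, the series agreeing on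
  \<open>M\<close> with an element of the coset of \<open>g\<close> modulo \<open>J_ideal\<close>.
  It is an open neighbourhood of the limit because \<open>V\<close> is open and saturated.\<close>

lemma limitin_R_class_imp_eventually:
  assumes lim: "limitin R_topology (\<lambda>x. R_class (s x)) (R_class g) F" and M: "finite M"
  shows "\<forall>\<^sub>F x in F. \<exists>j\<in>J_ideal. \<forall>m\<in>M. s x m = g m + j m"
proof -
  define V where "V = {f. \<exists>j\<in>J_ideal. \<forall>m\<in>M. f m = g m + j m}"
  \<comment> \<open>Saturation: on the finite set \<open>M\<close> an element of the closure agrees
    with an element of the ideal itself.\<close>
  have R_class_V: "R_class f \<in> R_class ` V \<longleftrightarrow> f \<in> V" for f
  proof
    assume "R_class f \<in> R_class ` V"
    then obtain v where v: "v \<in> V" "(\<lambda>m. f m - v m) \<in> J_closure"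
      by (auto simp: R_class_eq_iff)
    obtain j where j: "j \<in> J_ideal" "\<forall>m\<in>M. v m = g m + j m"
      using v(1) by (auto simp: V_def)
    obtain j' where j': "j' \<in> J_ideal" "\<forall>m\<in>M. j' m = f m - v m"
      using v(2) M unfolding J_closure_def in_closure_PS by blast
    have "(\<lambda>m. j m + j' m) \<in> J_ideal"
      using excess_ideal_add[of j' 0 j] j(1) j'(1) by (simp add: J_ideal_eq)
    then show "f \<in> V"
      unfolding V_def mem_Collect_eq by (rule bexI[rotated]) (use j j' in auto)
  qed auto
  \<comment> \<open>Membership in \<open>V\<close> depends only on the coefficients in
    \<open>M\<close>, so \<open>V\<close> is a union of basic open sets.\<close>
  have V_eq: "V = (\<Union>v\<in>V. PiE UNIV (\<lambda>m. if m \<in> M then {v m} else UNIV))"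
  proof (intro equalityI subsetI)
    fix f assume "f \<in> (\<Union>v\<in>V. PiE UNIV (\<lambda>m. if m \<in> M then {v m} else UNIV))"
    then obtain v where "v \<in> V" "f \<in> PiE UNIV (\<lambda>m. if m \<in> M then {v m} else UNIV)"
      by blast
    moreover from this(2) have "f m = v m" if "m \<in> M" for m
      using that by (auto simp: PiE_iff dest!: spec[of _ m])
    ultimately show "f \<in> V" by (simp add: V_def)
  qed (auto simp: PiE_iff)
  have "openin PS_topology (PiE UNIV (\<lambda>m. if m \<in> M then {v m} else UNIV))" for v
    unfolding PS_topology_def
    by (rule product_topology_basis) (use M in \<open>auto elim: finite_subset[rotated]\<close>)
  then have "openin PS_topology V"
    by (subst V_eq) (auto intro: openin_Union)
  have preimage: "{f \<in> topspace PS_topology. R_class f \<in> R_class ` V} = V"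
    by (auto simp: R_class_V PS_topology_def)
  have openin_iff: "openin PS_topology {f \<in> topspace PS_topology. R_class f \<in> U} = openin R_topology U"
    if "U \<subseteq> carrier R_ring" for U
    using that quotient_map_quotient_topology[of PS_topology R_class] topspace_R_topology
    unfolding quotient_map_def R_topology_def[symmetric] by simp
  have "openin R_topology (R_class ` V)"
    using \<open>openin PS_topology V\<close> openin_iff[of "R_class ` V"] by (simp add: preimage image_subset_iff)
  moreover have "g \<in> V"
    unfolding V_def J_ideal_eq mem_Collect_eq by (rule bexI[OF _ excess_ideal.zero]) simp
  ultimately have "\<forall>\<^sub>F x in F. R_class (s x) \<in> R_class ` V"
    using lim unfolding limitin_def by blast
  then show ?thesis
    unfolding R_class_V by (simp add: V_def)
qed

text \<open>Take a box around \<open>m\<close> and a finite \<open>S\<close> of Catalan monomials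
  containing all those of the box. There both truncations equal \<open>g\<close> up to ideal
  elements \<open>j\<close> and \<open>j'\<close>, whose difference vanishes at the non-Catalan
  monomials and hence on the whole box.\<close>

lemma catalan_coefficients_unique:
  fixes c d :: mpseries
  assumes c: "limitin R_topology (\<lambda>S. R_class (\<lambda>m. if m \<in> S then c m else 0)) (R_class g)
      (finite_subsets_at_top {\<alpha>. catalan_path \<alpha>})"
    and d: "limitin R_topology (\<lambda>S. R_class (\<lambda>m. if m \<in> S then d m else 0)) (R_class g)
      (finite_subsets_at_top {\<alpha>. catalan_path \<alpha>})"
    and m: "catalan_path m"
  shows "c m = d m"
proof -
  let ?F = "finite_subsets_at_top {\<alpha>. catalan_path \<alpha>}"
  obtain n where n: "m \<in> gbox n"
    using finite_subset_gbox[of "{m}"] by auto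
  have "\<forall>\<^sub>F S in ?F. S \<subseteq> {\<alpha>. catalan_path \<alpha>} \<and> gbox n \<inter> {\<alpha>. catalan_path \<alpha>} \<subseteq> S"
    unfolding eventually_finite_subsets_at_top
    by (intro exI[of _ "gbox n \<inter> {\<alpha>. catalan_path \<alpha>}"]) auto
  from eventually_conj[OF this eventually_conj[OF limitin_R_class_imp_eventually[OF c finite_gbox]
        limitin_R_class_imp_eventually[OF d finite_gbox]]]
  have "\<forall>\<^sub>F S in ?F.
      (S \<subseteq> {\<alpha>. catalan_path \<alpha>} \<and> gbox n \<inter> {\<alpha>. catalan_path \<alpha>} \<subseteq> S) \<and>
      (\<exists>j\<in>J_ideal. \<forall>m\<in>gbox n. (if m \<in> S then c m else 0) = g m + j m) \<and>
      (\<exists>j\<in>J_ideal. \<forall>m\<in>gbox n. (if m \<in> S then d m else 0) = g m + j m)"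
    .
  from eventually_happens'[OF finite_subsets_at_top_neq_bot this]
  obtain S where S: "S \<subseteq> {\<alpha>. catalan_path \<alpha>}" "gbox n \<inter> {\<alpha>. catalan_path \<alpha>} \<subseteq> S"
    and "\<exists>j\<in>J_ideal. \<forall>m\<in>gbox n. (if m \<in> S then c m else 0) = g m + j m"
    and "\<exists>j\<in>J_ideal. \<forall>m\<in>gbox n. (if m \<in> S then d m else 0) = g m + j m"
    by (elim exE conjE)
  then obtain j j' where j: "j \<in> J_ideal" "\<forall>m\<in>gbox n. (if m \<in> S then c m else 0) = g m + j m"
    and j': "j' \<in> J_ideal" "\<forall>m\<in>gbox n. (if m \<in> S then d m else 0) = g m + j' m"
    by blast
  have "(\<lambda>m. j m - j' m) m = 0"
  proof (rule excess_ideal_eq_0_on_gbox[OF _ _ n])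
    show "(\<lambda>m. j m - j' m) \<in> excess_ideal 0"
      using j j' by (intro excess_ideal_diff) (simp_all add: J_ideal_eq)
    show "j x - j' x = 0" if "x \<in> gbox n" "\<not> catalan_path x" for x
    proof -
      have "x \<notin> S" using that S by auto
      with that j(2) j'(2) have "0 = g x + j x" "0 = g x + j' x" by auto
      then show ?thesis by linarith
    qed
  qed
  moreover have "m \<in> S" using m n S by auto
  then have "c m = g m + j m" "d m = g m + j' m"
    using bspec[OF j(2) n] bspec[OF j'(2) n] by simp_all
  ultimately show ?thesis by simp
qed

theorem theorem1p1:
  shows "hilbert_basis R_ring R_topology (\<lambda>q. R_class (const_series q))
           (\<lambda>\<alpha>. R_class (monom_series \<alpha>)) {\<alpha>. catalan_path \<alpha>}"
proof -
  let ?A = "{\<alpha>. catalan_path \<alpha>}"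
  let ?s = "\<lambda>(c :: mpseries) S m. if m \<in> S then c m else 0"
  have lim_iff: "limitin R_topology (\<lambda>S. \<Oplus>\<^bsub>R_ring\<^esub>i\<in>S. R_class (const_series (c i)) \<otimes>\<^bsub>R_ring\<^esub>
      R_class (monom_series i)) r (finite_subsets_at_top ?A) \<longleftrightarrow>
      limitin R_topology (\<lambda>S. R_class (?s c S)) r (finite_subsets_at_top ?A)" for c r
  proof -
    have eq: "\<forall>\<^sub>F S in finite_subsets_at_top ?A. (\<Oplus>\<^bsub>R_ring\<^esub>i\<in>S. R_class (const_series (c i)) \<otimes>\<^bsub>R_ring\<^esub>
        R_class (monom_series i)) = R_class (?s c S)"
      by (rule eventually_finite_subsets_at_top_weakI) (rule R_class_sum_monom)
    then have eq': "\<forall>\<^sub>F S in finite_subsets_at_top ?A. R_class (?s c S) =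
        (\<Oplus>\<^bsub>R_ring\<^esub>i\<in>S. R_class (const_series (c i)) \<otimes>\<^bsub>R_ring\<^esub> R_class (monom_series i))"
      by (rule eventually_mono) (rule sym)
    show ?thesis
      by (rule iffI) (erule limitin_transform_eventually[OF eq], erule limitin_transform_eventually[OF eq'])
  qed
  have "\<exists>!c. c \<in> extensional ?A \<and>
      limitin R_topology (\<lambda>S. R_class (?s c S)) r (finite_subsets_at_top ?A)"
    if "r \<in> carrier R_ring" for r
  proof (rule ex_ex1I)
    obtain f where f: "r = R_class f" using R_class_surj \<open>r \<in> carrier R_ring\<close> by blast
    obtain c where c: "\<And>m. \<not> catalan_path m \<Longrightarrow> c m = 0" "(\<lambda>m. c m - f m) \<in> J_closure"
      using catalan_normal_form by blast
    have "continuous_map PS_topology R_topology R_class"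
      unfolding R_topology_def
      by (intro quotient_imp_continuous_map quotient_map_quotient_topology)
    then have "limitin R_topology (\<lambda>S. R_class (?s c S)) (R_class c) (finite_subsets_at_top ?A)"
      by (rule continuous_map_limit[unfolded comp_def]) (rule limitin_partial_sums, use c in auto)
    \<comment> \<open>Restriction makes the family extensional. It changes values only off the
      Catalan monomials, where truncation to \<open>S\<close> discards them.\<close>
    moreover have "\<forall>\<^sub>F S in finite_subsets_at_top ?A. R_class (?s c S) = R_class (?s (restrict c ?A) S)"
      by (rule eventually_finite_subsets_at_top_weakI) (auto intro!: arg_cong[of _ _ R_class] ext)
    ultimately have "limitin R_topology (\<lambda>S. R_class (?s (restrict c ?A) S)) (R_class c) (finite_subsets_at_top ?A)"
      by (rule limitin_transform_eventually[rotated])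
    moreover have "R_class c = r"
      using c(2) by (simp add: f R_class_eq_iff)
    ultimately show "\<exists>c. c \<in> extensional ?A \<and>
        limitin R_topology (\<lambda>S. R_class (?s c S)) r (finite_subsets_at_top ?A)"
      by (intro exI[of _ "restrict c ?A"]) simp
  next
    fix c d
    assume c: "c \<in> extensional ?A \<and>
        limitin R_topology (\<lambda>S. R_class (?s c S)) r (finite_subsets_at_top ?A)"
      and d: "d \<in> extensional ?A \<and>
        limitin R_topology (\<lambda>S. R_class (?s d S)) r (finite_subsets_at_top ?A)"
    obtain f where f: "r = R_class f" using R_class_surj \<open>r \<in> carrier R_ring\<close> by blast
    show "c = d"
      by (rule extensionalityI[of _ ?A])
         (use c d catalan_coefficients_unique[of c f d] in \<open>auto simp: f\<close>)
  qed
  then show ?thesis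
    unfolding hilbert_basis_def lim_iff by simp
qed

end
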